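(* Let $\mathcal{C}_d$ be the set system on $\{0,1\}^d$ consisting of all subsets of the form $R\cap\{0,1\}^d$ with $R$ an axis-parallel box in $\mathbb{R}^d$ (equivalently, all subcubes of $\{0,1\}^d$). Then, as $d\to\infty$, \[ \operatorname{herdisc}\mathcal{C}_d=2^{c_0d+o(d)},\qquad c_0=\log_2(2/\sqrt3). \] The same holds for the set system $\mathcal{A}_d(\{0,1\}^d)=\{A\cap\{0,1\}^d: A=[0,b_1]\times\cdots\times[0,b_d],\ b_i\ge0\}$ induced by anchored boxes.
   Context: For a set system $\mathcal{F}$ on ground set $V$, $\operatorname{disc}\mathcal{F}=\min_{x\in\{-1,1\}^V}\max_{F\in\mathcal{F}}\bigl|\sum_{v\in F}x_v\bigr|$, and $\operatorname{herdisc}\mathcal{F}=\max_{J\subseteq V}\operatorname{disc}(\mathcal{F}|_J)$, where $\mathcal{F}|_J=\{F\cap J:F\in\mathcal{F}\}$. *)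

theory Defs
  imports Complex_Main "HOL-Library.Landau_Symbols"
begin

text \<open>Discrepancy of a set system F on a finite ground set V: minimum over colourings
  chi : V -> {-1,1} (extended by 0 outside V) of the maximum imbalance over sets in F.
  The empty system has discrepancy 0.\<close>
definition colourings :: "'a set \<Rightarrow> ('a \<Rightarrow> int) set" where
  "colourings V = {chi. (\<forall>v\<in>V. chi v \<in> {-1, 1}) \<and> (\<forall>v. v \<notin> V \<longrightarrow> chi v = 0)}"

definition disc :: "'a set \<Rightarrow> 'a set set \<Rightarrow> int" where
  "disc V F = Min ((\<lambda>chi. Max (insert 0 ((\<lambda>S. \<bar>\<Sum>v\<in>S. chi v\<bar>) ` F))) ` colourings V)"

definition herdisc :: "'a set \<Rightarrow> 'a set set \<Rightarrow> int" where
  "herdisc V F = Max ((\<lambda>J. disc J ((\<lambda>S. S \<inter> J) ` F)) ` Pow V)"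

text \<open>Points of R^d are represented as functions nat => real, coordinates 0..d-1;
  the cube {0,1}^d has all coordinates >= d equal to 0.\<close>
definition cube :: "nat \<Rightarrow> (nat \<Rightarrow> real) set" where
  "cube d = {x. (\<forall>i<d. x i \<in> {0, 1}) \<and> (\<forall>i\<ge>d. x i = 0)}"

definition box_d :: "nat \<Rightarrow> (nat \<Rightarrow> real) \<Rightarrow> (nat \<Rightarrow> real) \<Rightarrow> (nat \<Rightarrow> real) set" where
  "box_d d a b = {x. \<forall>i<d. a i \<le> x i \<and> x i \<le> b i}"

definition subcubes :: "nat \<Rightarrow> (nat \<Rightarrow> real) set set" where
  "subcubes d = {box_d d a b \<inter> cube d | a b. True}"

definition anchored_boxes :: "nat \<Rightarrow> (nat \<Rightarrow> real) set set" where
  "anchored_boxes d = {box_d d (\<lambda>_. 0) b \<inter> cube d | b. \<forall>i<d. b i \<ge> 0}"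

end

theory Submission
  imports Defs "HOL-Library.FuncSet" "HOL-Real_Asymp.Real_Asymp"
begin

text \<open>
  Both bounds come from tensor powers of \<open>2 \<times> 2\<close> data, and lose only factors linear in \<open>d\<close>.

  Upper bound. Points and subcubes carry vectors of norm at most 1 whose inner product is
  \<open>(sqrt 3 / 2) ^ d\<close> or 0 according to membership. Signs for the points are found by a derandomised
  Gram-Schmidt walk: a fractional colouring \<open>x\<close> is moved along the direction in which the signed sum
  changes only by the component of a pivot vector orthogonal to the other uncoloured vectors. The sum over
  test vectors \<open>\<theta>\<close> of
  \<open>exp (\<langle>\<theta>, V x\<rangle> + 4 (|\<theta>|\<^sup>2 - x\<^sub>p\<^sup>2 dist\<^sup>2 (\<theta>, span (A - p)) - (1 - x\<^sub>p\<^sup>2) dist\<^sup>2 (\<theta>, span A)))\<close>,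
  where \<open>A\<close> is the set of uncoloured points and \<open>p\<close> the pivot, does not increase in one of the two
  directions.

  Lower bound. With suitable product weights the incidence matrix of points and anchored boxes has singular
  values \<open>sing True ^ m * sing False ^ (d - m)\<close> of multiplicity \<open>d choose m\<close>, with
  \<open>sing True + sing False = 2 / sqrt 3\<close>. For the best \<open>m\<close>, about half of \<open>d choose m\<close> points can be chosen
  greedily so that their images form a triangular system with large diagonal. If the hereditary discrepancy
  were small, rounding would give an integer vector with small image in each of the \<open>16 ^ k\<close> residue classes
  modulo 16, more than the triangular system has room for.
\<close>

section \<open>Hereditary discrepancy\<close>

lemma finite_colourings:
  assumes "finite V"
  shows "finite (colourings V)"
proof -
  have "colourings V = {chi. \<forall>v. (v \<in> V \<longrightarrow> chi v \<in> {-1, 1}) \<and> (v \<notin> V \<longrightarrow> chi v = (0::int))}"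
    by (auto simp: colourings_def)
  then show ?thesis using finite_set_of_finite_funs[OF assms, of "{-1,1}" "0::int"] by simp
qed

lemma colourings_nonempty: "colourings V \<noteq> {}"
proof -
  have "(\<lambda>v. if v \<in> V then 1 else 0) \<in> colourings V" by (auto simp: colourings_def)
  then show ?thesis by blast
qed

lemma disc_le:
  assumes "finite V" "finite F" "chi \<in> colourings V" "0 \<le> H"
    and "\<And>S. S \<in> F \<Longrightarrow> \<bar>\<Sum>v\<in>S. chi v\<bar> \<le> H"
  shows "disc V F \<le> H"
proof -
  have "disc V F \<le> Max (insert 0 ((\<lambda>S. \<bar>\<Sum>v\<in>S. chi v\<bar>) ` F))"
    unfolding disc_def using assms(3) finite_colourings[OF assms(1)] by (intro Min_le) auto
  also have "\<dots> \<le> H" using assms by (subst Max_le_iff) auto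
  finally show ?thesis .
qed

lemma disc_attained:
  assumes "finite V" "finite F"
  shows "\<exists>chi\<in>colourings V. \<forall>S\<in>F. \<bar>\<Sum>v\<in>S. chi v\<bar> \<le> disc V F"
proof -
  have "disc V F \<in> (\<lambda>chi. Max (insert 0 ((\<lambda>S. \<bar>\<Sum>v\<in>S. chi v\<bar>) ` F))) ` colourings V"
    unfolding disc_def using finite_colourings[OF assms(1)] colourings_nonempty
    by (intro Min_in) auto
  then obtain chi where "chi \<in> colourings V"
    "disc V F = Max (insert 0 ((\<lambda>S. \<bar>\<Sum>v\<in>S. chi v\<bar>) ` F))" by auto
  moreover have "\<bar>\<Sum>v\<in>S. chi v\<bar> \<le> Max (insert 0 ((\<lambda>S. \<bar>\<Sum>v\<in>S. chi v\<bar>) ` F))" if "S \<in> F" for S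
    using assms(2) that by (intro Max_ge) auto
  ultimately show ?thesis by auto
qed

lemma herdisc_le:
  assumes "finite V" "finite F" "0 \<le> (H::real)"
    and "\<And>J. J \<subseteq> V \<Longrightarrow> \<exists>chi\<in>colourings J. \<forall>S\<in>F. real_of_int \<bar>\<Sum>v\<in>S \<inter> J. chi v\<bar> \<le> H"
  shows "real_of_int (herdisc V F) \<le> H"
proof -
  \<comment> \<open>The discrepancy is an integer, so the real bound \<open>H\<close> may be
    replaced by its floor.\<close>
  have "disc J ((\<lambda>S. S \<inter> J) ` F) \<le> \<lfloor>H\<rfloor>" if J: "J \<subseteq> V" for J
  proof -
    obtain chi where chi: "chi \<in> colourings J" "\<forall>S\<in>F. real_of_int \<bar>\<Sum>v\<in>S \<inter> J. chi v\<bar> \<le> H"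
      using assms(4)[OF J] by blast
    show ?thesis
      using chi assms(2,3) finite_subset[OF J assms(1)]
      by (intro disc_le[where chi = chi]) (auto simp: le_floor_iff)
  qed
  then have "herdisc V F \<le> \<lfloor>H\<rfloor>"
    unfolding herdisc_def using assms(1) by (subst Max_le_iff) auto
  then show ?thesis by linarith
qed

lemma herdisc_attained:
  assumes "finite V" "finite F" "J \<subseteq> V"
  shows "\<exists>chi\<in>colourings J. \<forall>S\<in>F. \<bar>\<Sum>v\<in>S \<inter> J. chi v\<bar> \<le> herdisc V F"
proof -
  have "disc J ((\<lambda>S. S \<inter> J) ` F) \<le> herdisc V F"
    unfolding herdisc_def using assms by (intro Max_ge) auto
  then show ?thesis
    using disc_attained[OF finite_subset[OF assms(3,1)], of "(\<lambda>S. S \<inter> J) ` F"] assms(2)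
    by (fastforce intro: order_trans)
qed

lemma herdisc_nonneg:
  assumes "finite V" "finite F" "F \<noteq> {}"
  shows "0 \<le> herdisc V F"
  using herdisc_attained[OF assms(1,2), of "{}"] assms(3) by auto

section \<open>Residuals and distances to subspaces\<close>

definition ip :: "'k set \<Rightarrow> ('k \<Rightarrow> real) \<Rightarrow> ('k \<Rightarrow> real) \<Rightarrow> real" where
  "ip K f g = (\<Sum>k\<in>K. f k * g k)"

lemma ip_commute: "ip K f g = ip K g f"
  by (simp add: ip_def mult.commute)

lemma ip_self_nonneg: "0 \<le> ip K f f"
  by (simp add: ip_def sum_nonneg)

lemma ip_diff_left: "ip K (\<lambda>k. f k - g k) h = ip K f h - ip K g h"
  by (simp add: ip_def algebra_simps sum_subtractf)

lemma ip_diff_right: "ip K h (\<lambda>k. f k - g k) = ip K h f - ip K h g"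
  by (simp add: ip_def algebra_simps sum_subtractf)

lemma ip_scale_left: "ip K (\<lambda>k. a * f k) h = a * ip K f h"
  by (simp add: ip_def algebra_simps sum_distrib_left)

lemma ip_scale_right: "ip K h (\<lambda>k. a * f k) = a * ip K h f"
  by (simp add: ip_def algebra_simps sum_distrib_left)

lemma ip_sum_left: "ip K (\<lambda>k. \<Sum>j\<in>A. a j * f j k) h = (\<Sum>j\<in>A. a j * ip K (f j) h)"
  unfolding ip_def sum_distrib_left sum_distrib_right
  by (subst sum.swap) (simp add: mult.assoc)

lemma ip_sum_right: "ip K h (\<lambda>k. \<Sum>j\<in>A. a j * f j k) = (\<Sum>j\<in>A. a j * ip K h (f j))"
  unfolding ip_commute[of K h] by (rule ip_sum_left)

lemma ip_diff_self: "ip K (\<lambda>k. f k - g k) (\<lambda>k. f k - g k) = ip K f f - 2 * ip K f g + ip K g g"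
  by (simp add: ip_def algebra_simps sum_subtractf sum.distrib sum_distrib_left)

definition lincomb :: "('j \<Rightarrow> 'k \<Rightarrow> real) \<Rightarrow> 'j set \<Rightarrow> ('j \<Rightarrow> real) \<Rightarrow> 'k \<Rightarrow> real" where
  "lincomb v A a = (\<lambda>k. \<Sum>j\<in>A. a j * v j k)"

lemma ip_lincomb_right: "ip K r (lincomb v A a) = (\<Sum>j\<in>A. a j * ip K r (v j))"
  unfolding lincomb_def by (rule ip_sum_right)

definition is_residual :: "'k set \<Rightarrow> ('j \<Rightarrow> 'k \<Rightarrow> real) \<Rightarrow> 'j set \<Rightarrow> ('k \<Rightarrow> real) \<Rightarrow> ('k \<Rightarrow> real) \<Rightarrow> bool" where
  "is_residual K v A f r \<longleftrightarrow>
     (\<exists>a. r = (\<lambda>k. f k - lincomb v A a k)) \<and> (\<forall>j\<in>A. ip K r (v j) = 0)"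

text \<open>One Gram-Schmidt step per vector: the residual of \<open>f\<close> is corrected by a
  multiple of the residual \<open>w\<close> of the new vector, which keeps it orthogonal to the old
  ones.\<close>

lemma residual_exists:
  assumes "finite K" "finite A"
  shows "\<exists>r. is_residual K v A f r"
  using assms(2)
proof (induction A arbitrary: f rule: finite_induct)
  case empty
  show ?case by (auto simp: is_residual_def lincomb_def)
next
  case (insert p A)
  obtain r a where r: "r = (\<lambda>k. f k - lincomb v A a k)" "\<And>j. j \<in> A \<Longrightarrow> ip K r (v j) = 0"
    using insert.IH[of f] by (auto simp: is_residual_def)
  obtain w b where w: "w = (\<lambda>k. v p k - lincomb v A b k)" "\<And>j. j \<in> A \<Longrightarrow> ip K w (v j) = 0"
    using insert.IH[of "v p"] by (auto simp: is_residual_def)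
  \<comment> \<open>If \<open>w\<close> has norm 0, it vanishes on \<open>K\<close>; then
    \<open>r\<close> is already orthogonal to \<open>v p\<close> and the coefficient 0
    serves.\<close>
  define c where "c = (if ip K w w = 0 then 0 else ip K r w / ip K w w)"
  define r' where "r' = (\<lambda>k. r k - c * w k)"
  have rw: "ip K r w = ip K r (v p)"
    unfolding w(1) ip_diff_right ip_lincomb_right using r(2) by simp
  have ww: "ip K w w = ip K w (v p)"
  proof -
    have "ip K w w = ip K w (\<lambda>k. v p k - lincomb v A b k)" by (simp only: w(1)[symmetric])
    also have "\<dots> = ip K w (v p)" unfolding ip_diff_right ip_lincomb_right using w(2) by simp
    finally show ?thesis .
  qed
  have "ip K r' (v p) = 0"
  proof (cases "ip K w w = 0")
    case True
    then have "w k = 0" if "k \<in> K" for k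
      using that assms(1) by (auto simp: ip_def sum_nonneg_eq_0_iff)
    then have "ip K r w = 0" by (simp add: ip_def)
    then show ?thesis using True rw by (simp add: r'_def ip_diff_left c_def ip_scale_left)
  next
    case False
    then show ?thesis
      using rw ww unfolding r'_def ip_diff_left ip_scale_left c_def by simp
  qed
  moreover have "ip K r' (v j) = 0" if "j \<in> A" for j
    using r(2)[OF that] w(2)[OF that] by (simp add: r'_def ip_diff_left ip_scale_left)
  moreover have "r' = (\<lambda>k. f k - lincomb v (insert p A) (\<lambda>j. if j = p then c else a j - c * b j) k)"
  proof
    fix k
    have "(\<Sum>j\<in>A. (if j = p then c else a j - c * b j) * v j k) = (\<Sum>j\<in>A. a j * v j k - c * (b j * v j k))"
      using insert.hyps by (intro sum.cong) (auto simp: algebra_simps)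
    then show "r' k = f k - lincomb v (insert p A) (\<lambda>j. if j = p then c else a j - c * b j) k"
      using insert.hyps
      by (simp add: r'_def r(1) w(1) lincomb_def sum_subtractf sum_distrib_left[symmetric] algebra_simps)
  qed
  ultimately show ?case unfolding is_residual_def by blast
qed

text \<open>Linearly dependent vectors admit several families of coefficients, hence the choice
  operator; on \<open>K\<close> all of them give the same residual.\<close>

definition residual :: "'k set \<Rightarrow> ('j \<Rightarrow> 'k \<Rightarrow> real) \<Rightarrow> 'j set \<Rightarrow> ('k \<Rightarrow> real) \<Rightarrow> 'k \<Rightarrow> real" where
  "residual K v A f = (SOME r. is_residual K v A f r)"

definition sqdist :: "'k set \<Rightarrow> ('j \<Rightarrow> 'k \<Rightarrow> real) \<Rightarrow> 'j set \<Rightarrow> ('k \<Rightarrow> real) \<Rightarrow> real" where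
  "sqdist K v A f = ip K (residual K v A f) (residual K v A f)"

lemma residual:
  assumes "finite K" "finite A"
  obtains a where "residual K v A f = (\<lambda>k. f k - lincomb v A a k)"
    and "\<And>j. j \<in> A \<Longrightarrow> ip K (residual K v A f) (v j) = 0"
proof -
  have "is_residual K v A f (residual K v A f)"
    unfolding residual_def using residual_exists[OF assms] by (rule someI_ex)
  then show ?thesis using that by (auto simp: is_residual_def)
qed

lemma residual_lincomb:
  assumes "finite K" "finite A"
  shows "ip K (residual K v A f) (lincomb v A a) = 0"
  by (rule residual[OF assms, of v f]) (simp add: ip_lincomb_right)

text \<open>Pythagoras: \<open>f\<close> minus any combination is the residual plus an orthogonal
  vector from the span.\<close>

lemma sqdist_le:
  assumes "finite K" "finite A"
  shows "sqdist K v A f \<le> ip K (\<lambda>k. f k - lincomb v A a k) (\<lambda>k. f k - lincomb v A a k)"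
proof -
  define r where "r = residual K v A f"
  obtain b where r: "r = (\<lambda>k. f k - lincomb v A b k)"
    using residual[OF assms, of v f] unfolding r_def by metis
  have "(\<lambda>k. f k - lincomb v A a k) = (\<lambda>k. r k - lincomb v A (\<lambda>j. a j - b j) k)"
    by (simp add: r lincomb_def sum_subtractf algebra_simps)
  then have "ip K (\<lambda>k. f k - lincomb v A a k) (\<lambda>k. f k - lincomb v A a k)
      = ip K r r + ip K (lincomb v A (\<lambda>j. a j - b j)) (lincomb v A (\<lambda>j. a j - b j))"
    using residual_lincomb[OF assms, of v f "\<lambda>j. a j - b j"] by (simp add: ip_diff_self r_def)
  then show ?thesis
    using ip_self_nonneg[of K "lincomb v A (\<lambda>j. a j - b j)"] by (simp add: sqdist_def r_def)
qed

lemma sqdist_nonneg: "0 \<le> sqdist K v A f"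
  by (simp add: sqdist_def ip_self_nonneg)

lemma sqdist_le_self:
  assumes "finite K" "finite A"
  shows "sqdist K v A f \<le> ip K f f"
  using sqdist_le[OF assms, of v f "\<lambda>_. 0"] by (simp add: lincomb_def)

lemma sqdist_antimono:
  assumes "finite K" "finite B" "A \<subseteq> B"
  shows "sqdist K v B f \<le> sqdist K v A f"
proof -
  have A: "finite A" using assms finite_subset by blast
  obtain a where a: "residual K v A f = (\<lambda>k. f k - lincomb v A a k)"
    using residual[OF assms(1) A, of v f] by metis
  have "lincomb v A a = lincomb v B (\<lambda>j. if j \<in> A then a j else 0)"
    unfolding lincomb_def using assms by (intro ext sum.mono_neutral_cong_left) auto
  then show ?thesis
    using sqdist_le[OF assms(1,2), of v f "\<lambda>j. if j \<in> A then a j else 0"]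
    by (simp add: sqdist_def[of K v A] a)
qed

text \<open>Let \<open>w\<close> be the part of \<open>v p\<close> orthogonal to the span of
  \<open>A\<close> and \<open>s = ip K f w\<close>. Subtracting \<open>s * w\<close> from the
  residual of \<open>f\<close> lowers its squared norm by
  \<open>2 * s\<^sup>2 - s\<^sup>2 * ip K w w\<close>, which is at least \<open>s\<^sup>2\<close>
  because \<open>w\<close> has norm at most 1. The coefficient \<open>s\<close> in place of the
  optimal \<open>s / ip K w w\<close> avoids a case for \<open>w = 0\<close>.\<close>

lemma sqdist_insert:
  assumes "finite K" "finite A" "p \<notin> A" "ip K (v p) (v p) \<le> 1"
  shows "(ip K f (residual K v A (v p)))\<^sup>2 \<le> sqdist K v A f - sqdist K v (insert p A) f"
proof -
  define w where "w = residual K v A (v p)"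
  define r where "r = residual K v A f"
  obtain a where r: "r = (\<lambda>k. f k - lincomb v A a k)"
    using residual[OF assms(1,2), of v f] unfolding r_def by metis
  obtain b where w: "w = (\<lambda>k. v p k - lincomb v A b k)"
    using residual[OF assms(1,2), of v "v p"] unfolding w_def by metis
  have ww: "ip K w w \<le> 1"
    using sqdist_le_self[OF assms(1,2), of v "v p"] assms(4) by (simp add: sqdist_def w_def)
  define s where "s = ip K f w"
  \<comment> \<open>\<open>f\<close> and its residual \<open>r\<close> differ by an element of the
    span, to which \<open>w\<close> is orthogonal.\<close>
  have rw: "ip K r w = s"
    using residual_lincomb[OF assms(1,2), of v "v p" a]
    unfolding r ip_diff_left s_def w_def by (simp add: ip_commute[of K "lincomb v A a"])
  have eq: "(\<lambda>k. r k - s * w k) = (\<lambda>k. f k - lincomb v (insert p A) (\<lambda>j. if j = p then s else a j - s * b j) k)"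
  proof
    fix k
    have "(\<Sum>j\<in>A. (if j = p then s else a j - s * b j) * v j k) = (\<Sum>j\<in>A. a j * v j k - s * (b j * v j k))"
      using assms by (intro sum.cong) (auto simp: algebra_simps)
    then show "r k - s * w k = f k - lincomb v (insert p A) (\<lambda>j. if j = p then s else a j - s * b j) k"
      using assms by (simp add: r w lincomb_def sum_subtractf sum_distrib_left[symmetric] algebra_simps)
  qed
  have "sqdist K v (insert p A) f \<le> ip K (\<lambda>k. r k - s * w k) (\<lambda>k. r k - s * w k)"
    unfolding eq using assms by (intro sqdist_le) auto
  also have "\<dots> = ip K r r - 2 * s * ip K r w + s\<^sup>2 * ip K w w"
    unfolding ip_diff_self ip_scale_left ip_scale_right by (simp add: power2_eq_square)
  also have "\<dots> \<le> ip K r r - 2 * s * s + s\<^sup>2 * 1"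
    using ww by (intro add_mono mult_left_mono) (auto simp: rw)
  finally show ?thesis
    by (simp add: sqdist_def r_def s_def w_def power2_eq_square)
qed

section \<open>The Gram-Schmidt walk\<close>

lemma exp_le_quadratic:
  fixes t :: real
  assumes "\<bar>t\<bar> \<le> 1"
  shows "exp t \<le> 1 + t + t\<^sup>2"
proof (cases "t \<ge> 0")
  case True
  then show ?thesis using exp_bound[of t] assms by simp
next
  case False
  define y where "y = - t"
  have y: "y > 0" using False by (simp add: y_def)
  have "exp t = 1 / exp y" by (simp add: y_def exp_minus field_simps)
  also have "\<dots> \<le> 1 / (1 + y)" using y exp_ge_add_one_self[of y] by (intro divide_left_mono) auto
  also have "\<dots> \<le> 1 - y + y\<^sup>2"
  proof -
    have "(1 - y + y\<^sup>2) * (1 + y) = 1 + y ^ 3" by algebra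
    also have "\<dots> \<ge> 1" using y by simp
    finally show ?thesis using y by (simp add: divide_le_eq)
  qed
  finally show ?thesis by (simp add: y_def)
qed

text \<open>The growth of one potential term under a step \<open>\<delta>\<close> is bounded by an
  affine function of \<open>\<delta>\<close>, so the sign of the step can be chosen for the whole
  sum at once. The exponent is \<open>\<delta> * q\<close>; its second-order contribution
  \<open>\<delta>\<^sup>2 * q\<^sup>2\<close> is at most \<open>4 * \<delta>\<^sup>2 * D\<close>,
  which the drop \<open>- 4 * \<delta>\<^sup>2 * D\<close> contained in \<open>\<delta> * q\<close>
  cancels. The bound 1/256 on \<open>D\<close> keeps the exponent in the range of the quadratic
  estimate.\<close>

lemma exp_walk_step_le:
  fixes s x D \<delta> :: real
  assumes "s\<^sup>2 \<le> D" "D \<le> 1 / 256" "\<bar>x\<bar> \<le> 1" "\<bar>\<delta>\<bar> \<le> 2"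
  shows "exp (\<delta> * s - 4 * ((x + \<delta>)\<^sup>2 - x\<^sup>2) * D) \<le> 1 + \<delta> * (s - 8 * x * D)"
proof -
  define e where "e = sqrt D"
  have D: "0 \<le> D" using assms(1) zero_le_power2[of s] by linarith
  have "sqrt (1 / 256) = (1 / 16 :: real)" by (rule real_sqrt_unique) (auto simp: power2_eq_square)
  then have "e \<le> 1 / 16" unfolding e_def using real_sqrt_le_mono[OF assms(2)] by linarith
  then have e: "0 \<le> e" "e\<^sup>2 = D" "e \<le> 1 / 16" using D by (auto simp: e_def)
  have s: "\<bar>s\<bar> \<le> e" using real_sqrt_le_mono[OF assms(1)] by (simp add: e_def)
  have ee: "D \<le> e / 16" using mult_left_mono[OF e(3,1)] e(2) by (simp add: power2_eq_square)
  define q where "q = s - 8 * x * D - 4 * \<delta> * D"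
  have t: "\<delta> * s - 4 * ((x + \<delta>)\<^sup>2 - x\<^sup>2) * D = \<delta> * q"
    unfolding q_def by algebra
  have "\<bar>q\<bar> \<le> \<bar>s\<bar> + \<bar>8 * x * D\<bar> + \<bar>4 * \<delta> * D\<bar>" unfolding q_def by linarith
  also have "\<bar>8 * x * D\<bar> \<le> 8 * D" using assms(3) D by (simp add: abs_mult mult_left_le_one_le)
  also have "\<bar>4 * \<delta> * D\<bar> \<le> 8 * D" using mult_right_mono[OF assms(4) D] D by (simp add: abs_mult mult.commute)
  finally have q: "\<bar>q\<bar> \<le> 2 * e" using s ee by simp
  have "\<bar>\<delta> * q\<bar> \<le> 2 * (2 * e)" unfolding abs_mult using q assms(4) by (intro mult_mono) auto
  then have "\<bar>\<delta> * q\<bar> \<le> 1" using e by simp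
  then have "exp (\<delta> * q) \<le> 1 + \<delta> * q + \<delta>\<^sup>2 * q\<^sup>2"
    using exp_le_quadratic[of "\<delta> * q"] by (simp add: power_mult_distrib)
  also have "q\<^sup>2 \<le> 4 * D" using power_mono[OF q, of 2] e by (simp add: power_mult_distrib)
  then have "1 + \<delta> * q + \<delta>\<^sup>2 * q\<^sup>2 \<le> 1 + \<delta> * q + \<delta>\<^sup>2 * (4 * D)"
    by (intro add_left_mono mult_left_mono) auto
  also have "\<dots> = 1 + \<delta> * (s - 8 * x * D)" unfolding q_def by algebra
  finally show ?thesis by (simp only: t)
qed

lemma hit_boundary:
  fixes x u :: "'a \<Rightarrow> real"
  assumes "finite A" "p \<in> A" "u p \<noteq> 0" "\<And>j. j \<in> A \<Longrightarrow> \<bar>x j\<bar> < 1"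
  obtains \<delta> where "\<delta> > 0" "\<And>j. j \<in> A \<Longrightarrow> \<bar>x j + \<delta> * u j\<bar> \<le> 1" "\<exists>j\<in>A. \<bar>x j + \<delta> * u j\<bar> = 1"
proof -
  \<comment> \<open>\<open>\<tau> j\<close> is the time at which coordinate \<open>j\<close>, moving
    with speed \<open>u j\<close>, reaches the end \<open>sgn (u j)\<close> of its interval.\<close>
  define \<tau> where "\<tau> j = (1 - sgn (u j) * x j) / \<bar>u j\<bar>" for j
  define B where "B = {j \<in> A. u j \<noteq> 0}"
  have B: "finite B" "B \<noteq> {}" using assms by (auto simp: B_def)
  define \<delta> where "\<delta> = Min (\<tau> ` B)"
  have pos: "\<tau> j > 0" if "j \<in> B" for j
  proof -
    have "0 < 1 - sgn (u j) * x j"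
      using that assms(4)[of j] by (auto simp: B_def sgn_if abs_if split: if_splits)
    then show ?thesis using that by (simp add: \<tau>_def B_def)
  qed
  have \<delta>: "\<delta> > 0" unfolding \<delta>_def using B pos by (subst Min_gr_iff) auto
  have le: "\<bar>x j + \<delta> * u j\<bar> \<le> 1" if j: "j \<in> A" for j
  proof (cases "u j = 0")
    case True
    then show ?thesis using assms(4)[OF j] by simp
  next
    case False
    then have "\<delta> \<le> \<tau> j" unfolding \<delta>_def using B j by (intro Min_le) (auto simp: B_def)
    then have "\<delta> * \<bar>u j\<bar> \<le> 1 - sgn (u j) * x j" using False by (simp add: \<tau>_def pos_le_divide_eq)
    moreover have "0 \<le> \<delta> * \<bar>u j\<bar>" using \<delta> by simp
    ultimately show ?thesis using assms(4)[OF j] False by (auto simp: sgn_if abs_if split: if_splits)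
  qed
  have "\<delta> \<in> \<tau> ` B" unfolding \<delta>_def using B by (intro Min_in) auto
  then obtain j where j: "j \<in> B" "\<delta> = \<tau> j" by auto
  then have "\<delta> * \<bar>u j\<bar> = 1 - sgn (u j) * x j" by (simp add: \<tau>_def B_def)
  then have "\<bar>x j + \<delta> * u j\<bar> = 1" using j by (auto simp: sgn_if abs_if B_def split: if_splits)
  then show ?thesis using that \<delta> le j by (auto simp: B_def)
qed

text \<open>The other uncoloured coordinates compensate the projection of the pivot vector on their
  span, so moving along \<open>u\<close> changes the signed sum only by the orthogonal part.\<close>

lemma pivot_direction:
  assumes "finite K" "finite J" "A \<subseteq> J" "p \<in> A"
  obtains u where "u p = 1" "\<And>j. j \<notin> A \<Longrightarrow> u j = 0"
    "lincomb v J u = residual K v (A - {p}) (v p)"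
proof -
  have A: "finite (A - {p})" using assms finite_subset by blast
  obtain a where a: "residual K v (A - {p}) (v p) = (\<lambda>k. v p k - lincomb v (A - {p}) a k)"
    using residual[OF assms(1) A, of v "v p"] by metis
  define u where "u j = (if j = p then 1 else if j \<in> A then - a j else 0)" for j
  have "lincomb v J u k = v p k - lincomb v (A - {p}) a k" for k
  proof -
    have "lincomb v J u k = (\<Sum>j\<in>insert p (A - {p}). u j * v j k)"
      unfolding lincomb_def using assms by (intro sum.mono_neutral_right) (auto simp: u_def)
    also have "\<dots> = v p k + (\<Sum>j\<in>A - {p}. u j * v j k)"
      using A by (subst sum.insert) (auto simp: u_def)
    also have "(\<Sum>j\<in>A - {p}. u j * v j k) = (\<Sum>j\<in>A - {p}. - (a j * v j k))"
      by (intro sum.cong) (auto simp: u_def)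
    finally show ?thesis by (simp add: lincomb_def sum_negf)
  qed
  then have "lincomb v J u = residual K v (A - {p}) (v p)" using a by auto
  moreover have "u p = 1" "\<And>j. j \<notin> A \<Longrightarrow> u j = 0" using assms(4) by (auto simp: u_def)
  ultimately show ?thesis using that by blast
qed

text \<open>Every step colours at least one more coordinate, which gives the induction. The factor
  \<open>(x p)\<^sup>2\<close> interpolates between the distances to the spans with and without the
  pivot, so that the potential remains usable when the pivot gets coloured and another one takes
  over.\<close>

lemma gram_schmidt_walk_from:
  fixes v :: "'j \<Rightarrow> 'k \<Rightarrow> real" and \<theta> :: "'i \<Rightarrow> 'k \<Rightarrow> real" and x :: "'j \<Rightarrow> real"
  assumes K: "finite K" and J: "finite J" and I: "finite I"
    and v: "\<And>j. j \<in> J \<Longrightarrow> ip K (v j) (v j) \<le> 1"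
    and \<theta>: "\<And>i. i \<in> I \<Longrightarrow> ip K (\<theta> i) (\<theta> i) \<le> 1 / 256"
    and "\<And>j. j \<in> J \<Longrightarrow> \<bar>x j\<bar> \<le> 1" "A = {j \<in> J. \<bar>x j\<bar> < 1}" "p \<in> A"
  shows "\<exists>y. (\<forall>j\<in>J. \<bar>y j\<bar> = 1) \<and>
    (\<Sum>i\<in>I. exp (ip K (\<theta> i) (lincomb v J y))) \<le>
    (\<Sum>i\<in>I. exp (ip K (\<theta> i) (lincomb v J x) + 4 * (ip K (\<theta> i) (\<theta> i)
       - (x p)\<^sup>2 * sqdist K v (A - {p}) (\<theta> i) - (1 - (x p)\<^sup>2) * sqdist K v A (\<theta> i))))"
  using assms(6-)
proof (induction "card A" arbitrary: x A p rule: less_induct)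
  case less
  define pot where "pot A p x i = exp (ip K (\<theta> i) (lincomb v J x) + 4 * (ip K (\<theta> i) (\<theta> i)
       - (x p)\<^sup>2 * sqdist K v (A - {p}) (\<theta> i) - (1 - (x p)\<^sup>2) * sqdist K v A (\<theta> i)))" for A p x i
  define good where "good B \<longleftrightarrow> (\<exists>y. (\<forall>j\<in>J. \<bar>y j\<bar> = 1) \<and>
    (\<Sum>i\<in>I. exp (ip K (\<theta> i) (lincomb v J y))) \<le> B)" for B
  have good_mono: "good B'" if "good B" "B \<le> B'" for B B'
    using that unfolding good_def by (meson order_trans)
  have AJ: "A \<subseteq> J" and finA: "finite A" using less.prems J by auto
  have sq1: "(z j)\<^sup>2 \<le> 1" if "\<bar>z j\<bar> \<le> 1" for z :: "'j \<Rightarrow> real" and j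
    using that by (simp add: abs_square_le_1)
  \<comment> \<open>The induction hypothesis covers any state with fewer uncoloured coordinates;
    what remains is that re-evaluating the potential for the smaller set, and possibly a new pivot,
    does not increase it.\<close>
  have next_state: "good (\<Sum>i\<in>I. pot A p x' i)"
    if x': "\<And>j. j \<in> J \<Longrightarrow> \<bar>x' j\<bar> \<le> 1" and sub: "{j \<in> J. \<bar>x' j\<bar> < 1} \<subset> A" for x'
  proof -
    define A' where "A' = {j \<in> J. \<bar>x' j\<bar> < 1}"
    have A': "A' \<subseteq> A" "finite A'" "card A' < card A"
      using sub finA psubset_card_mono[OF finA sub] finite_subset by (auto simp: A'_def)
    have IH: "good (\<Sum>i\<in>I. pot A' q x' i)" if "q \<in> A'" for q
      unfolding good_def pot_def using A'(3) x' A'_def that by (rule less.hyps)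
    show ?thesis
    proof (cases "p \<in> A'")
      case True
      \<comment> \<open>The pivot survives: distances to smaller spans are larger, and they enter
        the exponent negatively with nonnegative weights.\<close>
      show ?thesis
      proof (rule good_mono[OF IH[OF True]], rule sum_mono)
        fix i
        have "(x' p)\<^sup>2 * sqdist K v (A - {p}) (\<theta> i) \<le> (x' p)\<^sup>2 * sqdist K v (A' - {p}) (\<theta> i)"
          using K finA A' by (intro mult_left_mono sqdist_antimono) auto
        moreover have "(1 - (x' p)\<^sup>2) * sqdist K v A (\<theta> i) \<le> (1 - (x' p)\<^sup>2) * sqdist K v A' (\<theta> i)"
          using K finA A' sq1[of x' p] x'[of p] less.prems AJ
          by (intro mult_left_mono sqdist_antimono) auto
        ultimately show "pot A' p x' i \<le> pot A p x' i" by (simp add: pot_def)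
      qed
    next
      case False
      have "p \<in> J" using less.prems AJ by auto
      then have "\<bar>x' p\<bar> = 1" using False x'[of p] by (auto simp: A'_def)
      then have xp: "(x' p)\<^sup>2 = 1" by (metis power2_abs one_power2)
      \<comment> \<open>Once the pivot is coloured, only the distance to the span without it is left
        in the potential.\<close>
      have pA: "pot A p x' i = exp (ip K (\<theta> i) (lincomb v J x')
          + 4 * (ip K (\<theta> i) (\<theta> i) - sqdist K v (A - {p}) (\<theta> i)))" for i
        by (simp add: pot_def xp)
      show ?thesis
      proof (cases "A' = {}")
        case True
        have y: "\<forall>j\<in>J. \<bar>x' j\<bar> = 1" using True x' by (force simp: A'_def)
        have "(\<Sum>i\<in>I. exp (ip K (\<theta> i) (lincomb v J x'))) \<le> (\<Sum>i\<in>I. pot A p x' i)"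
        proof (rule sum_mono)
          fix i
          show "exp (ip K (\<theta> i) (lincomb v J x')) \<le> pot A p x' i"
            using sqdist_le_self[OF K, of "A - {p}" v "\<theta> i"] finA by (simp add: pA)
        qed
        then show ?thesis using y unfolding good_def by blast
      next
        case False
        then obtain q where q: "q \<in> A'" by blast
        show ?thesis
        proof (rule good_mono[OF IH[OF q]], rule sum_mono)
          fix i
          \<comment> \<open>Both distances for the new pivot \<open>q\<close> are at least
            \<open>R\<close>, as \<open>A'\<close> lies in \<open>A - {p}\<close>; hence so is their
            convex combination with weights \<open>(x' q)\<^sup>2\<close> and
            \<open>1 - (x' q)\<^sup>2\<close>.\<close>
          define R where "R = sqdist K v (A - {p}) (\<theta> i)"
          have "R \<le> sqdist K v A' (\<theta> i)" "R \<le> sqdist K v (A' - {q}) (\<theta> i)"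
            unfolding R_def using K finA A' \<open>p \<notin> A'\<close> by (auto intro!: sqdist_antimono)
          then have "(x' q)\<^sup>2 * R \<le> (x' q)\<^sup>2 * sqdist K v (A' - {q}) (\<theta> i)"
            "(1 - (x' q)\<^sup>2) * R \<le> (1 - (x' q)\<^sup>2) * sqdist K v A' (\<theta> i)"
            using sq1[of x' q] x'[of q] q A' AJ by (auto intro!: mult_left_mono)
          then have "R \<le> (x' q)\<^sup>2 * sqdist K v (A' - {q}) (\<theta> i) + (1 - (x' q)\<^sup>2) * sqdist K v A' (\<theta> i)"
            by (simp add: algebra_simps)
          then show "pot A' q x' i \<le> pot A p x' i" by (simp add: pA) (simp add: pot_def R_def)
        qed
      qed
    qed
  qed
  define w where "w = residual K v (A - {p}) (v p)"
  obtain u where u: "u p = 1" "\<And>j. j \<notin> A \<Longrightarrow> u j = 0" "lincomb v J u = w"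
    using pivot_direction[OF K J AJ less.prems(3), of v] unfolding w_def by metis
  have xA: "\<And>j. j \<in> A \<Longrightarrow> \<bar>x j\<bar> < 1" using less.prems by auto
  obtain a where a: "a > 0" "\<And>j. j \<in> A \<Longrightarrow> \<bar>x j + a * u j\<bar> \<le> 1" "\<exists>j\<in>A. \<bar>x j + a * u j\<bar> = 1"
    using hit_boundary[OF finA less.prems(3), of u x] u xA by (metis zero_neq_one)
  obtain b where b: "b > 0" "\<And>j. j \<in> A \<Longrightarrow> \<bar>x j + b * - u j\<bar> \<le> 1" "\<exists>j\<in>A. \<bar>x j + b * - u j\<bar> = 1"
    using hit_boundary[OF finA less.prems(3), of "\<lambda>j. - u j" x] u xA by (metis zero_neq_one neg_equal_0_iff_equal)
  have step: "good (\<Sum>i\<in>I. pot A p (\<lambda>j. x j + \<delta> * u j) i)"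
    if \<delta>: "\<And>j. j \<in> A \<Longrightarrow> \<bar>x j + \<delta> * u j\<bar> \<le> 1" "\<exists>j\<in>A. \<bar>x j + \<delta> * u j\<bar> = 1" for \<delta>
  proof (rule next_state)
    show "\<bar>x j + \<delta> * u j\<bar> \<le> 1" if "j \<in> J" for j
      using \<delta>(1)[of j] u(2)[of j] less.prems(1)[OF that] by (cases "j \<in> A") auto
    have "{j \<in> J. \<bar>x j + \<delta> * u j\<bar> < 1} \<subseteq> A"
    proof
      fix j assume "j \<in> {j \<in> J. \<bar>x j + \<delta> * u j\<bar> < 1}"
      then show "j \<in> A" using u(2)[of j] less.prems(2) by (cases "j \<in> A") auto
    qed
    then show "{j \<in> J. \<bar>x j + \<delta> * u j\<bar> < 1} \<subset> A" using \<delta>(2) by fastforce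
  qed
  have potstep: "pot A p (\<lambda>j. x j + \<delta> * u j) i \<le> pot A p x i * (1 + \<delta> *
        (ip K (\<theta> i) w - 8 * x p * (sqdist K v (A - {p}) (\<theta> i) - sqdist K v A (\<theta> i))))"
    if i: "i \<in> I" and \<delta>: "\<bar>x p + \<delta>\<bar> \<le> 1" for \<delta> i
  proof -
    define s where "s = ip K (\<theta> i) w"
    define D where "D = sqdist K v (A - {p}) (\<theta> i) - sqdist K v A (\<theta> i)"
    have "insert p (A - {p}) = A" using less.prems by auto
    then have "s\<^sup>2 \<le> D"
      using sqdist_insert[OF K, of "A - {p}" p v "\<theta> i"] v[of p] finA less.prems(3) AJ
      by (auto simp: s_def w_def D_def)
    moreover have "D \<le> 1 / 256"
      using \<theta>[OF i] sqdist_le_self[OF K, of "A - {p}" v "\<theta> i"] sqdist_nonneg[of K v A "\<theta> i"] finA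
      by (auto simp: D_def)
    moreover have "\<bar>x p\<bar> \<le> 1" using xA[OF less.prems(3)] by simp
    moreover have "\<bar>\<delta>\<bar> \<le> 2" using \<delta> xA[OF less.prems(3)] by linarith
    ultimately have E: "exp (\<delta> * s - 4 * ((x p + \<delta>)\<^sup>2 - (x p)\<^sup>2) * D) \<le> 1 + \<delta> * (s - 8 * x p * D)"
      by (rule exp_walk_step_le)
    have lin: "ip K (\<theta> i) (lincomb v J (\<lambda>j. x j + \<delta> * u j)) = ip K (\<theta> i) (lincomb v J x) + \<delta> * s"
      unfolding s_def u(3)[symmetric] ip_lincomb_right
      by (simp add: algebra_simps sum.distrib sum_distrib_left)
    have "pot A p (\<lambda>j. x j + \<delta> * u j) i = pot A p x i * exp (\<delta> * s - 4 * ((x p + \<delta>)\<^sup>2 - (x p)\<^sup>2) * D)"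
      unfolding pot_def lin exp_add[symmetric] D_def using u(1) by (simp add: algebra_simps)
    also have "\<dots> \<le> pot A p x i * (1 + \<delta> * (s - 8 * x p * D))"
      using E by (intro mult_left_mono) (auto simp: pot_def)
    finally show ?thesis by (simp add: s_def D_def)
  qed
  \<comment> \<open>The potential after a step \<open>\<delta>\<close> lies below a line of slope
    \<open>M\<close>. The sign of \<open>M\<close> decides between the forward step \<open>a\<close>
    and the backward step \<open>- b\<close>, both of which end on the boundary; this replaces the
    random choice.\<close>
  define \<Psi> where "\<Psi> \<delta> = (\<Sum>i\<in>I. pot A p (\<lambda>j. x j + \<delta> * u j) i)" for \<delta>
  define M where "M = (\<Sum>i\<in>I. pot A p x i *
        (ip K (\<theta> i) w - 8 * x p * (sqdist K v (A - {p}) (\<theta> i) - sqdist K v A (\<theta> i))))"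
  have \<Psi>: "\<Psi> \<delta> \<le> (\<Sum>i\<in>I. pot A p x i) + \<delta> * M" if "\<bar>x p + \<delta>\<bar> \<le> 1" for \<delta>
  proof -
    have "\<Psi> \<delta> \<le> (\<Sum>i\<in>I. pot A p x i * (1 + \<delta> *
        (ip K (\<theta> i) w - 8 * x p * (sqdist K v (A - {p}) (\<theta> i) - sqdist K v A (\<theta> i)))))"
      unfolding \<Psi>_def using potstep that by (intro sum_mono) auto
    also have "\<dots> = (\<Sum>i\<in>I. pot A p x i) + \<delta> * M"
      unfolding M_def sum_distrib_left sum.distrib[symmetric]
      by (intro sum.cong) (auto simp: algebra_simps)
    finally show ?thesis .
  qed
  have "good (\<Sum>i\<in>I. pot A p x i)"
  proof (cases "M \<le> 0")
    case True
    have "\<bar>x p + a\<bar> \<le> 1" using a(2)[OF less.prems(3)] u(1) by simp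
    then have "\<Psi> a \<le> (\<Sum>i\<in>I. pot A p x i) + a * M" by (rule \<Psi>)
    also have "\<dots> \<le> (\<Sum>i\<in>I. pot A p x i)" using True a(1) by (simp add: mult_nonneg_nonpos)
    finally show ?thesis using good_mono[OF step[OF a(2,3)]] by (simp add: \<Psi>_def)
  next
    case False
    have "\<bar>x p + - b\<bar> \<le> 1" using b(2)[OF less.prems(3)] u(1) by simp
    then have "\<Psi> (- b) \<le> (\<Sum>i\<in>I. pot A p x i) + - b * M" by (rule \<Psi>)
    also have "\<dots> \<le> (\<Sum>i\<in>I. pot A p x i)" using False b(1) by simp
    finally show ?thesis using good_mono[OF step[of "- b"]] b(2,3) by (simp add: \<Psi>_def)
  qed
  then show ?case by (simp add: good_def pot_def)
qed

text \<open>The walk starts at 0, where each term of the potential is at most 2. A final bound on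
  the sum of exponentials bounds each of them, and taking logarithms gives the claim.\<close>

theorem vector_balancing:
  fixes v :: "'j \<Rightarrow> 'k \<Rightarrow> real" and \<theta> :: "'i \<Rightarrow> 'k \<Rightarrow> real"
  assumes K: "finite K" and J: "finite J" and I: "finite I"
    and v: "\<And>j. j \<in> J \<Longrightarrow> ip K (v j) (v j) \<le> 1"
    and \<theta>: "\<And>i. i \<in> I \<Longrightarrow> ip K (\<theta> i) (\<theta> i) \<le> 1"
  shows "\<exists>y. (\<forall>j\<in>J. \<bar>y j\<bar> = 1) \<and>
    (\<forall>i\<in>I. \<bar>\<Sum>j\<in>J. y j * ip K (\<theta> i) (v j)\<bar> \<le> 16 * ln (4 * real (card I)))"
proof -
  \<comment> \<open>Both signs of each test vector are included to control absolute values; the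
    factor 1/16 brings squared norms down to 1/256, as the walk requires.\<close>
  define \<psi> where "\<psi> = (\<lambda>(i, \<epsilon> :: bool) k. (if \<epsilon> then 1 / 16 else - 1 / 16) * \<theta> i k)"
  have \<psi>: "ip K (\<psi> (i, \<epsilon>)) h = (if \<epsilon> then 1 / 16 else - 1 / 16) * ip K (\<theta> i) h" for i \<epsilon> h
    unfolding \<psi>_def by (simp only: prod.case ip_scale_left)
  have \<psi>': "ip K (\<psi> i) (\<psi> i) \<le> 1 / 256" if mem: "i \<in> I \<times> UNIV" for i
  proof -
    obtain i' \<epsilon> where i: "i = (i', \<epsilon>)" "i' \<in> I" using mem by (cases i) auto
    have "ip K (\<psi> i) (\<psi> i) = 1 / 256 * ip K (\<theta> i') (\<theta> i')"
      unfolding i \<psi> ip_commute[of K "\<theta> i'" "\<psi> (i', \<epsilon>)"] by auto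
    then show ?thesis using \<theta>[OF i(2)] by simp
  qed
  have "\<exists>y. (\<forall>j\<in>J. \<bar>y j\<bar> = 1) \<and> (\<Sum>i\<in>I \<times> UNIV. exp (ip K (\<psi> i) (lincomb v J y))) \<le> (\<Sum>i\<in>I \<times> (UNIV :: bool set). 2)"
  proof (cases "J = {}")
    case True
    then show ?thesis by (auto simp: lincomb_def ip_def intro!: sum_mono)
  next
    case False
    then obtain p where p: "p \<in> J" by blast
    have "\<exists>y. (\<forall>j\<in>J. \<bar>y j\<bar> = 1) \<and>
      (\<Sum>i\<in>I \<times> UNIV. exp (ip K (\<psi> i) (lincomb v J y))) \<le>
      (\<Sum>i\<in>I \<times> UNIV. exp (ip K (\<psi> i) (lincomb v J (\<lambda>_. 0)) + 4 * (ip K (\<psi> i) (\<psi> i)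
       - 0\<^sup>2 * sqdist K v (J - {p}) (\<psi> i) - (1 - 0\<^sup>2) * sqdist K v J (\<psi> i))))"
      by (rule gram_schmidt_walk_from) (use K J I v \<psi>' p in auto)
    then obtain y where y: "\<forall>j\<in>J. \<bar>y j\<bar> = 1" and le: "(\<Sum>i\<in>I \<times> UNIV. exp (ip K (\<psi> i) (lincomb v J y))) \<le>
      (\<Sum>i\<in>I \<times> UNIV. exp (ip K (\<psi> i) (lincomb v J (\<lambda>_. 0)) + 4 * (ip K (\<psi> i) (\<psi> i)
       - 0\<^sup>2 * sqdist K v (J - {p}) (\<psi> i) - (1 - 0\<^sup>2) * sqdist K v J (\<psi> i))))"
      by blast
    note le
    also have "\<dots> \<le> (\<Sum>i\<in>I \<times> (UNIV :: bool set). 2)"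
    proof (rule sum_mono)
      fix i assume i: "i \<in> I \<times> (UNIV :: bool set)"
      \<comment> \<open>At the origin the signed sum vanishes and the exponent is at most
        4/256.\<close>
      have "ip K (\<psi> i) (lincomb v J (\<lambda>_. 0)) + 4 * (ip K (\<psi> i) (\<psi> i)
       - 0\<^sup>2 * sqdist K v (J - {p}) (\<psi> i) - (1 - 0\<^sup>2) * sqdist K v J (\<psi> i)) \<le> 1 / 2"
        using \<psi>'[OF i] sqdist_nonneg[of K v J "\<psi> i"] by (simp add: ip_lincomb_right)
      then show "exp (ip K (\<psi> i) (lincomb v J (\<lambda>_. 0)) + 4 * (ip K (\<psi> i) (\<psi> i)
       - 0\<^sup>2 * sqdist K v (J - {p}) (\<psi> i) - (1 - 0\<^sup>2) * sqdist K v J (\<psi> i))) \<le> 2"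
        using order_trans[OF _ exp_half_le2] by simp
    qed
    finally show ?thesis using y by blast
  qed
  then obtain y where y: "\<forall>j\<in>J. \<bar>y j\<bar> = 1"
    and le: "(\<Sum>i\<in>I \<times> UNIV. exp (ip K (\<psi> i) (lincomb v J y))) \<le> (\<Sum>i\<in>I \<times> (UNIV :: bool set). 2)"
    by blast
  have "\<bar>\<Sum>j\<in>J. y j * ip K (\<theta> i) (v j)\<bar> \<le> 16 * ln (4 * real (card I))" if i: "i \<in> I" for i
  proof -
    define z where "z = (\<Sum>j\<in>J. y j * ip K (\<theta> i) (v j))"
    have pos: "card I > 0" using i I by (auto simp: card_gt_0_iff)
    have "(if \<epsilon> then 1 / 16 else - 1 / 16) * z \<le> ln (4 * real (card I))" for \<epsilon>
    proof -
      have "exp ((if \<epsilon> then 1 / 16 else - 1 / 16) * z) = exp (ip K (\<psi> (i, \<epsilon>)) (lincomb v J y))"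
        by (simp only: \<psi> ip_lincomb_right z_def sum_distrib_left mult.left_commute)
      also have "\<dots> \<le> (\<Sum>i\<in>I \<times> UNIV. exp (ip K (\<psi> i) (lincomb v J y)))"
        using i I by (intro member_le_sum) auto
      also have "\<dots> \<le> 4 * real (card I)"
        using le by (simp add: card_cartesian_product)
      finally show ?thesis using pos by (subst ln_ge_iff) auto
    qed
    from this[of True] this[of False] show ?thesis by (auto simp: z_def[symmetric])
  qed
  then show ?thesis using y by blast
qed

section \<open>Subcubes: upper bound\<close>

lemma sum_Pow_prod:
  fixes \<phi> :: "nat \<Rightarrow> bool \<Rightarrow> real"
  shows "(\<Sum>T\<in>Pow {..<d}. \<Prod>i<d. \<phi> i (i \<in> T)) = (\<Prod>i<d. \<phi> i True + \<phi> i False)"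
proof -
  have "(\<Prod>i<d. \<phi> i (i \<in> T)) = (\<Prod>i\<in>T. \<phi> i True) * (\<Prod>i\<in>{..<d} - T. \<phi> i False)"
    if "T \<subseteq> {..<d}" for T
    using prod.subset_diff[OF that, of "\<lambda>i. \<phi> i (i \<in> T)"] by (simp add: mult.commute)
  then show ?thesis by (subst prod_add) auto
qed

lemma ip_Pow_prod:
  fixes \<phi> \<psi> :: "nat \<Rightarrow> bool \<Rightarrow> real"
  shows "ip (Pow {..<d}) (\<lambda>T. \<Prod>i<d. \<phi> i (i \<in> T)) (\<lambda>T. \<Prod>i<d. \<psi> i (i \<in> T))
   = (\<Prod>i<d. \<phi> i True * \<psi> i True + \<phi> i False * \<psi> i False)"
  using sum_Pow_prod[of "\<lambda>i b. \<phi> i b * \<psi> i b" d] by (simp add: ip_def prod.distrib)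

lemma prod_of_bool: "(\<Prod>i<d. of_bool (P i)) = (of_bool (\<forall>i<d. P i) :: real)" for d :: nat
  by (induction d) (auto simp: less_Suc_eq)

section \<open>Points and boxes of the cube in terms of coordinate sets\<close>

definition vertex :: "nat \<Rightarrow> nat set \<Rightarrow> nat \<Rightarrow> real" where
  "vertex d T i = (if i < d \<and> i \<in> T then 1 else 0)"

lemma cube_eq: "cube d = vertex d ` Pow {..<d}"
proof (intro equalityI subsetI)
  fix x assume x: "x \<in> cube d"
  have "x = vertex d {i. i < d \<and> x i = 1}"
  proof
    fix i show "x i = vertex d {i. i < d \<and> x i = 1} i"
      using x by (cases "i < d") (auto simp: cube_def vertex_def)
  qed
  then show "x \<in> vertex d ` Pow {..<d}" by blast
qed (auto simp: cube_def vertex_def)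

lemma finite_cube: "finite (cube d)"
  by (simp add: cube_eq)

lemma inj_on_vertex: "inj_on (vertex d) (Pow {..<d})"
proof (rule inj_onI)
  fix S T assume ST: "S \<in> Pow {..<d}" "T \<in> Pow {..<d}" "vertex d S = vertex d T"
  have "i \<in> S \<longleftrightarrow> i \<in> T" for i
    using fun_cong[OF ST(3), of i] ST(1,2) by (auto simp: vertex_def split: if_splits)
  then show "S = T" by blast
qed

lemma finite_subcubes: "finite (subcubes d)"
proof (rule finite_subset)
  show "subcubes d \<subseteq> Pow (cube d)" by (auto simp: subcubes_def)
  show "finite (Pow (cube d))" using finite_cube by simp
qed

lemma anchored_subset_subcubes: "anchored_boxes d \<subseteq> subcubes d"
  by (auto simp: anchored_boxes_def subcubes_def)

lemma finite_anchored_boxes: "finite (anchored_boxes d)"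
  by (rule finite_subset[OF anchored_subset_subcubes finite_subcubes])

text \<open>The indicator of \<open>S\<close> serves as upper corner: coordinates in
  \<open>S\<close> are free and the others are forced to 0.\<close>

lemma anchored_boxI: "vertex d ` Pow S \<in> anchored_boxes d" if "S \<subseteq> {..<d}" for S
proof -
  have "vertex d ` Pow S = box_d d (\<lambda>_. 0) (vertex d S) \<inter> cube d"
  proof (intro equalityI subsetI)
    fix x assume "x \<in> vertex d ` Pow S"
    then show "x \<in> box_d d (\<lambda>_. 0) (vertex d S) \<inter> cube d"
      using that by (auto simp: box_d_def cube_def vertex_def)
  next
    fix x assume x: "x \<in> box_d d (\<lambda>_. 0) (vertex d S) \<inter> cube d"
    then obtain T where T: "T \<subseteq> {..<d}" "x = vertex d T" by (auto simp: cube_eq)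
    have "i \<in> S" if "i \<in> T" for i
    proof -
      have "i < d" using T that by auto
      then have "vertex d T i \<le> vertex d S i" using x T by (auto simp: box_d_def)
      then show ?thesis using that \<open>i < d\<close> by (auto simp: vertex_def split: if_splits)
    qed
    then show "x \<in> vertex d ` Pow S" using T by auto
  qed
  then show ?thesis by (auto simp: anchored_boxes_def vertex_def intro!: exI[of _ "vertex d S"])
qed

lemma anchored_boxes_nonempty: "anchored_boxes d \<noteq> {}"
  using anchored_boxI[of "{}" d] by auto

text \<open>Unit vectors in the plane: those of the two points of \<open>{0, 1}\<close> enclose an angle of 60 degrees, and
  the vector of a subset of \<open>{0, 1}\<close> is orthogonal to the points outside it and has inner product
  \<open>sqrt 3 / 2\<close> with the points inside.\<close>
definition point_vec :: "bool \<Rightarrow> bool \<Rightarrow> real" where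
  "point_vec x c = (if c then (if x then 1 / 2 else - 1 / 2) else sqrt 3 / 2)"

definition side_vec :: "bool \<Rightarrow> bool \<Rightarrow> bool \<Rightarrow> real" where
  "side_vec lo hi c =
    (if lo \<and> hi then (if c then 0 else 1)
     else if hi then (if c then sqrt 3 / 2 else 1 / 2)
     else if lo then (if c then - sqrt 3 / 2 else 1 / 2)
     else 0)"

lemma point_vec_norm: "point_vec x True * point_vec x True + point_vec x False * point_vec x False = 1"
  by (simp add: point_vec_def)

lemma side_vec_norm: "side_vec lo hi True * side_vec lo hi True + side_vec lo hi False * side_vec lo hi False \<in> {0..1}"
  by (simp add: side_vec_def)

lemma side_vec_point_vec:
  "side_vec lo hi True * point_vec x True + side_vec lo hi False * point_vec x False
   = sqrt 3 / 2 * of_bool (if x then hi else lo)"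
  by (simp add: side_vec_def point_vec_def)

text \<open>The planar vectors are tensored over the coordinates. Balancing the point vectors
  against all subcube vectors bounds each imbalance times \<open>(sqrt 3 / 2) ^ d\<close>, and
  dividing by this factor gives the exponent.\<close>

theorem herdisc_subcubes_le:
  assumes F: "F \<subseteq> subcubes d"
  shows "real_of_int (herdisc (cube d) F) \<le> 32 * (real d + 1) * (2 / sqrt 3) ^ d"
proof (rule herdisc_le[OF finite_cube])
  show "finite F" using F finite_subcubes finite_subset by blast
  show "0 \<le> 32 * (real d + 1) * (2 / sqrt 3) ^ d" by simp
  fix J assume J: "J \<subseteq> cube d"
  define v where "v = (\<lambda>x T. \<Prod>i<d. point_vec (x i = (1::real)) (i \<in> T))"
  define \<theta> where "\<theta> = (\<lambda>(L, U) T. \<Prod>i<d. side_vec (i \<in> L) (i \<in> U) (i \<in> (T :: nat set)))"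
  define I where "I = Pow {..<d} \<times> Pow {..<d}"
  have v: "ip (Pow {..<d}) (v x) (v x) \<le> 1" for x
    unfolding v_def using ip_Pow_prod[of d "\<lambda>i. point_vec (x i = 1)" "\<lambda>i. point_vec (x i = 1)"]
    by (simp add: point_vec_norm)
  have \<theta>: "ip (Pow {..<d}) (\<theta> i) (\<theta> i) \<le> 1" for i
  proof (cases i)
    case (Pair L U)
    have "ip (Pow {..<d}) (\<theta> i) (\<theta> i) = (\<Prod>i<d. side_vec (i \<in> L) (i \<in> U) True * side_vec (i \<in> L) (i \<in> U) True
        + side_vec (i \<in> L) (i \<in> U) False * side_vec (i \<in> L) (i \<in> U) False)"
      unfolding \<theta>_def Pair prod.case by (rule ip_Pow_prod)
    also have "\<dots> \<le> 1" using side_vec_norm by (intro prod_le_1) auto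
    finally show ?thesis .
  qed
  have \<theta>v: "ip (Pow {..<d}) (\<theta> (L, U)) (v x)
      = (sqrt 3 / 2) ^ d * of_bool (\<forall>i<d. if x i = 1 then i \<in> U else i \<in> L)" for L U x
  proof -
    have "ip (Pow {..<d}) (\<theta> (L, U)) (v x) = (\<Prod>i<d. side_vec (i \<in> L) (i \<in> U) True * point_vec (x i = 1) True
        + side_vec (i \<in> L) (i \<in> U) False * point_vec (x i = 1) False)"
      unfolding \<theta>_def v_def prod.case by (rule ip_Pow_prod)
    then show ?thesis
      unfolding side_vec_point_vec prod.distrib prod_of_bool by simp
  qed
  have finJ: "finite J" using J finite_cube finite_subset by blast
  have finI: "finite I" by (simp add: I_def)
  have "finite (Pow {..<d})" by simp
  from vector_balancing[OF this finJ finI, of v \<theta>, OF v \<theta>]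
  obtain y where y: "\<forall>x\<in>J. \<bar>y x\<bar> = 1"
    and bd: "\<forall>i\<in>I. \<bar>\<Sum>x\<in>J. y x * ip (Pow {..<d}) (\<theta> i) (v x)\<bar> \<le> 16 * ln (4 * real (card I))"
    by blast
  define chi where "chi x = (if x \<in> J then if y x = 1 then 1 else -1 else 0 :: int)" for x
  have chi: "chi \<in> colourings J" by (auto simp: colourings_def chi_def)
  have chiy: "real_of_int (chi x) = y x" if "x \<in> J" for x
    using bspec[OF y that] that by (auto simp: chi_def)
  \<comment> \<open>There are \<open>4 ^ d\<close> pairs \<open>(L, U)\<close>, so the logarithm
    contributes only a factor linear in \<open>d\<close>.\<close>
  have cardI: "16 * ln (4 * real (card I)) \<le> 32 * (real d + 1)"
  proof -
    have "4 * real (card I) = 4 ^ Suc d"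
      by (simp add: I_def card_cartesian_product card_Pow power_mult_distrib[symmetric])
    then have "ln (4 * real (card I)) = (real d + 1) * ln 4" by (simp only: ln_realpow) (simp add: algebra_simps)
    also have "\<dots> \<le> (real d + 1) * 2"
    proof (rule mult_left_mono)
      have "ln (4 :: real) = 2 * ln 2" using ln_realpow[of 2 2] by simp
      also have "\<dots> \<le> 2" using ln_le_minus_one[of "2 :: real"] by simp
      finally show "ln (4 :: real) \<le> 2" .
    qed simp
    finally show ?thesis by simp
  qed
  show "\<exists>chi\<in>colourings J. \<forall>S\<in>F. real_of_int \<bar>\<Sum>v\<in>S \<inter> J. chi v\<bar> \<le> 32 * (real d + 1) * (2 / sqrt 3) ^ d"
  proof (intro bexI[OF _ chi] ballI)
    fix S assume "S \<in> F"
    then obtain a b where S: "S = box_d d a b \<inter> cube d" using F by (auto simp: subcubes_def)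
    \<comment> \<open>A box meets the cube in the points whose zeros lie in \<open>L\<close> and
      whose ones lie in \<open>U\<close>. A coordinate in neither set makes the box miss the cube
      and the test vector vanish.\<close>
    define L where "L = {i. i < d \<and> a i \<le> 0 \<and> 0 \<le> b i}"
    define U where "U = {i. i < d \<and> a i \<le> 1 \<and> 1 \<le> b i}"
    have LU: "(L, U) \<in> I" by (auto simp: L_def U_def I_def)
    have mem: "x \<in> S \<longleftrightarrow> (\<forall>i<d. if x i = 1 then i \<in> U else i \<in> L)" if "x \<in> J" for x
    proof -
      have x: "x \<in> cube d" using that J by auto
      then have "(a i \<le> x i \<and> x i \<le> b i) \<longleftrightarrow> (if x i = 1 then i \<in> U else i \<in> L)" if "i < d" for i
        using that by (auto simp: cube_def L_def U_def)
      then show ?thesis using x by (auto simp: S box_d_def)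
    qed
    have "real_of_int (\<Sum>x\<in>S \<inter> J. chi x) = (\<Sum>x\<in>J. y x * of_bool (x \<in> S))"
      using finJ by (auto simp: chiy intro!: sum.mono_neutral_cong_left)
    then have "(sqrt 3 / 2) ^ d * real_of_int (\<Sum>x\<in>S \<inter> J. chi x)
        = (\<Sum>x\<in>J. (sqrt 3 / 2) ^ d * (y x * of_bool (x \<in> S)))"
      by (simp only: sum_distrib_left)
    also have "\<dots> = (\<Sum>x\<in>J. y x * ip (Pow {..<d}) (\<theta> (L, U)) (v x))"
      unfolding \<theta>v using mem by (intro sum.cong) (simp_all only: mult.left_commute)
    finally have "\<bar>(sqrt 3 / 2) ^ d * real_of_int (\<Sum>x\<in>S \<inter> J. chi x)\<bar> \<le> 32 * (real d + 1)"
      using bspec[OF bd LU] cardI by linarith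
    then have "(sqrt 3 / 2) ^ d * real_of_int \<bar>\<Sum>x\<in>S \<inter> J. chi x\<bar> \<le> 32 * (real d + 1)"
      unfolding abs_mult by simp
    then have "(2 / sqrt 3) ^ d * ((sqrt 3 / 2) ^ d * real_of_int \<bar>\<Sum>x\<in>S \<inter> J. chi x\<bar>)
        \<le> (2 / sqrt 3) ^ d * (32 * (real d + 1))"
      by (intro mult_left_mono) auto
    then show "real_of_int \<bar>\<Sum>v\<in>S \<inter> J. chi v\<bar> \<le> 32 * (real d + 1) * (2 / sqrt 3) ^ d"
      unfolding mult.assoc[symmetric] power_mult_distrib[symmetric] by (simp add: algebra_simps)
  qed
qed

section \<open>Hereditary discrepancy and triangular systems\<close>

text \<open>Rounding the binary digits of \<open>n / 2 ^ t\<close> one at a time, starting with the lowest, costs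
  \<open>H / 2 + H / 4 + \<dots>\<close>.\<close>
lemma hereditary_rounding:
  fixes n :: "'a \<Rightarrow> int" and H :: real
  assumes "finite V"
    and col: "\<And>J. J \<subseteq> V \<Longrightarrow> \<exists>chi\<in>colourings J. \<forall>S\<in>F. real_of_int \<bar>\<Sum>v\<in>S \<inter> J. chi v\<bar> \<le> H"
  shows "\<exists>x :: 'a \<Rightarrow> int. \<forall>S\<in>F. real_of_int \<bar>\<Sum>v\<in>S \<inter> V. 2 ^ t * x v - n v\<bar> \<le> (2 ^ t - 1) * H"
proof (induction t arbitrary: n)
  case 0
  show ?case by (intro exI[of _ n]) simp
next
  case (Suc t)
  \<comment> \<open>Colouring exactly the odd entries makes every \<open>n v + chi v\<close> even,
    so it can be halved and handed to the induction hypothesis.\<close>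
  define J where "J = {v \<in> V. odd (n v)}"
  obtain chi where chi: "chi \<in> colourings J"
    and bd: "\<And>S. S \<in> F \<Longrightarrow> real_of_int \<bar>\<Sum>v\<in>S \<inter> J. chi v\<bar> \<le> H"
    using col[of J] by (auto simp: J_def)
  define m where "m v = (n v + chi v) div 2" for v
  have m: "2 * m v = n v + chi v" if "v \<in> V" for v
  proof -
    have "even (n v + chi v)"
      using chi that by (cases "odd (n v)") (auto simp: colourings_def J_def)
    then show ?thesis by (simp add: m_def)
  qed
  obtain x where x: "\<And>S. S \<in> F \<Longrightarrow> real_of_int \<bar>\<Sum>v\<in>S \<inter> V. 2 ^ t * x v - m v\<bar> \<le> (2 ^ t - 1) * H"
    using Suc.IH[of m] by blast
  show ?case
  proof (intro exI[of _ x] ballI)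
    fix S assume S: "S \<in> F"
    have "(\<Sum>v\<in>S \<inter> V. 2 ^ Suc t * x v - n v) = (\<Sum>v\<in>S \<inter> V. 2 * (2 ^ t * x v - m v) + chi v)"
      using m by (intro sum.cong) (auto simp: algebra_simps)
    also have "\<dots> = 2 * (\<Sum>v\<in>S \<inter> V. 2 ^ t * x v - m v) + (\<Sum>v\<in>S \<inter> V. chi v)"
      by (simp only: sum.distrib sum_distrib_left)
    also have "(\<Sum>v\<in>S \<inter> V. chi v) = (\<Sum>v\<in>S \<inter> J. chi v)"
      using chi assms(1) by (intro sum.mono_neutral_right) (auto simp: colourings_def J_def)
    finally have "\<bar>\<Sum>v\<in>S \<inter> V. 2 ^ Suc t * x v - n v\<bar>
        \<le> 2 * \<bar>\<Sum>v\<in>S \<inter> V. 2 ^ t * x v - m v\<bar> + \<bar>\<Sum>v\<in>S \<inter> J. chi v\<bar>"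
      by linarith
    then have "real_of_int \<bar>\<Sum>v\<in>S \<inter> V. 2 ^ Suc t * x v - n v\<bar>
        \<le> 2 * real_of_int \<bar>\<Sum>v\<in>S \<inter> V. 2 ^ t * x v - m v\<bar> + real_of_int \<bar>\<Sum>v\<in>S \<inter> J. chi v\<bar>"
      by linarith
    also have "\<dots> \<le> 2 * ((2 ^ t - 1) * H) + H"
      using x[OF S] bd[OF S] by linarith
    finally show "real_of_int \<bar>\<Sum>v\<in>S \<inter> V. 2 ^ Suc t * x v - n v\<bar> \<le> (2 ^ Suc t - 1) * H"
      by (simp add: algebra_simps)
  qed
qed

text \<open>On either side of the sign change of the affine function the terms are dominated by a
  geometric series of ratio \<open>exp (- h)\<close>, whose sum is at most
  \<open>1 + 1 / h\<close>.\<close>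

lemma sum_exp_neg_abs_le:
  fixes h c :: real
  assumes "finite Z" "h > 0"
  shows "(\<Sum>n\<in>Z. exp (- \<bar>h * real_of_int n + c\<bar>)) \<le> 2 + 2 / h"
proof -
  define r where "r = exp (- h)"
  have r: "0 < r" "r < 1" using assms by (auto simp: r_def)
  have geom: "(\<Sum>n\<in>N. r ^ n) \<le> 1 + 1 / h" if "finite N" for N :: "nat set"
  proof -
    have "(\<Sum>n\<in>N. r ^ n) \<le> (\<Sum>n. r ^ n)"
      using r that by (intro sum_le_suminf summable_geometric) auto
    also have "\<dots> = 1 / (1 - r)" using r by (intro suminf_geometric) auto
    also have "\<dots> \<le> 1 + 1 / h"
    proof -
      have "r \<le> 1 / (1 + h)"
        unfolding r_def exp_minus using assms exp_ge_add_one_self[of h] by (simp add: divide_simps)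
      then have "h / (1 + h) \<le> 1 - r" using assms by (simp add: field_simps)
      then have "1 / (1 - r) \<le> 1 / (h / (1 + h))"
        using assms r by (intro divide_left_mono mult_pos_pos divide_pos_pos) auto
      also have "\<dots> = 1 + 1 / h" using assms by (simp add: field_simps)
      finally show ?thesis .
    qed
    finally show ?thesis .
  qed
  define n0 where "n0 = \<lceil>- c / h\<rceil>"
  have n0: "h * real_of_int n0 + c \<ge> 0" "h * (real_of_int n0 - 1) + c \<le> 0"
  proof -
    have "- c / h \<le> real_of_int n0" "real_of_int n0 - 1 \<le> - c / h" unfolding n0_def by linarith+
    then show "h * real_of_int n0 + c \<ge> 0" "h * (real_of_int n0 - 1) + c \<le> 0"
      using assms by (auto simp: field_simps)
  qed
  have up: "(\<Sum>n\<in>{n\<in>Z. n \<ge> n0}. exp (- \<bar>h * real_of_int n + c\<bar>)) \<le> 1 + 1 / h"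
  proof -
    have "(\<Sum>n\<in>{n\<in>Z. n \<ge> n0}. exp (- \<bar>h * real_of_int n + c\<bar>))
        \<le> (\<Sum>n\<in>{n\<in>Z. n \<ge> n0}. r ^ nat (n - n0))"
    proof (intro sum_mono)
      fix n assume n: "n \<in> {n\<in>Z. n \<ge> n0}"
      have "h * real_of_int (n - n0) \<le> \<bar>h * real_of_int n + c\<bar>"
        using n0 by (simp add: algebra_simps)
      then show "exp (- \<bar>h * real_of_int n + c\<bar>) \<le> r ^ nat (n - n0)"
        using n unfolding r_def exp_of_nat_mult[symmetric] by (simp add: algebra_simps)
    qed
    also have "\<dots> = (\<Sum>n\<in>(\<lambda>n. nat (n - n0)) ` {n\<in>Z. n \<ge> n0}. r ^ n)"
      by (subst sum.reindex) (auto simp: inj_on_def)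
    also have "\<dots> \<le> 1 + 1 / h" using assms by (intro geom) auto
    finally show ?thesis .
  qed
  have down: "(\<Sum>n\<in>{n\<in>Z. n < n0}. exp (- \<bar>h * real_of_int n + c\<bar>)) \<le> 1 + 1 / h"
  proof -
    have "(\<Sum>n\<in>{n\<in>Z. n < n0}. exp (- \<bar>h * real_of_int n + c\<bar>))
        \<le> (\<Sum>n\<in>{n\<in>Z. n < n0}. r ^ nat (n0 - 1 - n))"
    proof (intro sum_mono)
      fix n assume n: "n \<in> {n\<in>Z. n < n0}"
      have "h * real_of_int (n0 - 1 - n) \<le> \<bar>h * real_of_int n + c\<bar>"
        using n0 by (simp add: algebra_simps)
      then show "exp (- \<bar>h * real_of_int n + c\<bar>) \<le> r ^ nat (n0 - 1 - n)"
        using n unfolding r_def exp_of_nat_mult[symmetric] by (simp add: algebra_simps)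
    qed
    also have "\<dots> = (\<Sum>n\<in>(\<lambda>n. nat (n0 - 1 - n)) ` {n\<in>Z. n < n0}. r ^ n)"
      by (subst sum.reindex) (auto simp: inj_on_def)
    also have "\<dots> \<le> 1 + 1 / h" using assms by (intro geom) auto
    finally show ?thesis .
  qed
  have "(\<Sum>n\<in>Z. exp (- \<bar>h * real_of_int n + c\<bar>))
      = (\<Sum>n\<in>{n\<in>Z. n \<ge> n0} \<union> {n\<in>Z. n < n0}. exp (- \<bar>h * real_of_int n + c\<bar>))"
    by (intro sum.cong) auto
  also have "\<dots> = (\<Sum>n\<in>{n\<in>Z. n \<ge> n0}. exp (- \<bar>h * real_of_int n + c\<bar>))
      + (\<Sum>n\<in>{n\<in>Z. n < n0}. exp (- \<bar>h * real_of_int n + c\<bar>))"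
    using assms by (intro sum.union_disjoint) auto
  also have "\<dots> \<le> 2 + 2 / h" using up down by simp
  finally show ?thesis .
qed

text \<open>A volume bound for integer points in triangular coordinates. The shift of the last form
  is constant on \<open>Y\<close>, so \<open>Y\<close> is grouped by its last coordinate: each group
  is bounded by induction and the sum over the groups is one-dimensional.\<close>

lemma triangular_exp_sum_le:
  fixes g :: "nat \<Rightarrow> (nat \<Rightarrow> int) \<Rightarrow> real" and h :: "nat \<Rightarrow> real"
  assumes "finite Y" "h0 > 0" "\<And>s. s < k \<Longrightarrow> h0 \<le> h s"
    and "\<And>y y'. \<lbrakk>y \<in> Y; y' \<in> Y; \<And>t. t < k \<Longrightarrow> y t = y' t\<rbrakk> \<Longrightarrow> y = y'"
    and "\<And>s y y'. \<lbrakk>y \<in> Y; y' \<in> Y; s < k; \<And>t. s < t \<Longrightarrow> t < k \<Longrightarrow> y t = y' t\<rbrakk> \<Longrightarrow> g s y = g s y'"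
  shows "(\<Sum>y\<in>Y. exp (- (\<Sum>s<k. \<bar>h s * real_of_int (y s) + g s y\<bar>))) \<le> (2 + 2 / h0) ^ k"
  using assms
proof (induction k arbitrary: Y)
  case 0
  have "Y = {} \<or> (\<exists>y. Y = {y})" using 0(4) by (metis insert_iff not_less_zero subsetI subset_antisym ex_in_conv)
  then show ?case by auto
next
  case (Suc k)
  show ?case
  proof (cases "Y = {}")
    case False
    then obtain y0 where y0: "y0 \<in> Y" by blast
    have gk: "g k y = g k y0" if "y \<in> Y" for y
      using Suc.prems(5)[OF that y0, of k] by auto
    define w where "w n = exp (- \<bar>h k * real_of_int n + g k y0\<bar>)" for n
    have "(\<Sum>y\<in>Y. exp (- (\<Sum>s<Suc k. \<bar>h s * real_of_int (y s) + g s y\<bar>)))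
        = (\<Sum>y\<in>Y. w (y k) * exp (- (\<Sum>s<k. \<bar>h s * real_of_int (y s) + g s y\<bar>)))"
      by (intro sum.cong) (auto simp: w_def gk exp_add[symmetric])
    also have "\<dots> = (\<Sum>n\<in>(\<lambda>y. y k) ` Y. \<Sum>y\<in>{y\<in>Y. y k = n}.
        w (y k) * exp (- (\<Sum>s<k. \<bar>h s * real_of_int (y s) + g s y\<bar>)))"
      using Suc.prems(1) by (rule sum.image_gen)
    also have "\<dots> = (\<Sum>n\<in>(\<lambda>y. y k) ` Y. w n * (\<Sum>y\<in>{y\<in>Y. y k = n}.
        exp (- (\<Sum>s<k. \<bar>h s * real_of_int (y s) + g s y\<bar>))))"
      by (intro sum.cong) (auto simp: sum_distrib_left)
    also have "\<dots> \<le> (\<Sum>n\<in>(\<lambda>y. y k) ` Y. w n * (2 + 2 / h0) ^ k)"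
    proof (intro sum_mono mult_left_mono)
      fix n
      show "(\<Sum>y\<in>{y\<in>Y. y k = n}. exp (- (\<Sum>s<k. \<bar>h s * real_of_int (y s) + g s y\<bar>))) \<le> (2 + 2 / h0) ^ k"
      proof (rule Suc.IH)
        fix y y' assume "y \<in> {y\<in>Y. y k = n}" "y' \<in> {y\<in>Y. y k = n}" "\<And>t. t < k \<Longrightarrow> y t = y' t"
        then show "y = y'" by (intro Suc.prems(4)) (auto simp: less_Suc_eq)
      next
        fix s y y' assume "y \<in> {y\<in>Y. y k = n}" "y' \<in> {y\<in>Y. y k = n}" "s < k"
          "\<And>t. s < t \<Longrightarrow> t < k \<Longrightarrow> y t = y' t"
        then show "g s y = g s y'" by (intro Suc.prems(5)) (auto simp: less_Suc_eq)
      qed (use Suc.prems in auto)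
    qed (simp add: w_def)
    also have "\<dots> = (\<Sum>n\<in>(\<lambda>y. y k) ` Y. w n) * (2 + 2 / h0) ^ k"
      by (simp add: sum_distrib_right)
    also have "\<dots> \<le> (2 + 2 / h0) * (2 + 2 / h0) ^ k"
    proof (intro mult_right_mono)
      have hk: "h0 \<le> h k" "h k > 0" using Suc.prems(2) Suc.prems(3)[of k] by auto
      have "(\<Sum>n\<in>(\<lambda>y. y k) ` Y. w n) \<le> 2 + 2 / h k"
        unfolding w_def using Suc.prems(1) hk by (intro sum_exp_neg_abs_le) auto
      also have "\<dots> \<le> 2 + 2 / h0" using hk Suc.prems(2) by (auto intro!: divide_left_mono)
      finally show "(\<Sum>n\<in>(\<lambda>y. y k) ` Y. w n) \<le> 2 + 2 / h0" .
    qed (use Suc.prems(2) in auto)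
    finally show ?thesis by simp
  qed (use Suc.prems(2) in auto)
qed

lemma ip_residual_orthonormal:
  fixes h :: "'k \<Rightarrow> real"
  assumes "finite I" "\<And>i j. i \<in> I \<Longrightarrow> j \<in> I \<Longrightarrow> ip K (e i) (e j) = of_bool (i = j)"
  defines "r \<equiv> \<lambda>k. h k - lincomb e I (\<lambda>i. ip K (e i) h) k"
  shows "ip K r r = ip K h h - (\<Sum>i\<in>I. (ip K (e i) h)\<^sup>2)"
    and "\<And>i. i \<in> I \<Longrightarrow> ip K r (e i) = 0"
proof -
  define l where "l = lincomb e I (\<lambda>i. ip K (e i) h)"
  have l: "ip K (e j) l = ip K (e j) h" if "j \<in> I" for j
  proof -
    have "ip K (e j) l = (\<Sum>i\<in>I. ip K (e i) h * ip K (e j) (e i))"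
      unfolding l_def by (rule ip_lincomb_right)
    also have "\<dots> = (\<Sum>i\<in>I. if i = j then ip K (e j) h else 0)"
      using assms(2) that by (intro sum.cong) auto
    finally show ?thesis using assms(1) that by simp
  qed
  have "ip K l l = (\<Sum>i\<in>I. ip K (e i) h * ip K l (e i))"
    by (subst (2) l_def) (rule ip_lincomb_right)
  also have "\<dots> = (\<Sum>i\<in>I. (ip K (e i) h)\<^sup>2)"
    using l by (intro sum.cong) (auto simp: ip_commute[of K l] power2_eq_square)
  finally have ll: "ip K l l = (\<Sum>i\<in>I. (ip K (e i) h)\<^sup>2)" .
  have "ip K h l = (\<Sum>i\<in>I. (ip K (e i) h)\<^sup>2)"
    unfolding l_def ip_lincomb_right by (intro sum.cong) (auto simp: ip_commute[of K h] power2_eq_square)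
  then show "ip K r r = ip K h h - (\<Sum>i\<in>I. (ip K (e i) h)\<^sup>2)"
    unfolding r_def l_def[symmetric] ip_diff_self using ll by simp
  show "ip K r (e i) = 0" if "i \<in> I" for i
    unfolding r_def l_def[symmetric] ip_diff_left ip_commute[of K h "e i"] ip_commute[of K l "e i"]
    using l[OF that] by simp
qed

lemma bessel:
  assumes "finite I" "\<And>i j. i \<in> I \<Longrightarrow> j \<in> I \<Longrightarrow> ip K (e i) (e j) = of_bool (i = j)"
  shows "(\<Sum>i\<in>I. (ip K (e i) h)\<^sup>2) \<le> ip K h h"
  using ip_residual_orthonormal(1)[OF assms, of h] ip_self_nonneg[of K "\<lambda>k. h k - lincomb e I (\<lambda>i. ip K (e i) h) k"]
  by simp

text \<open>The weight is absorbed as a factor \<open>sqrt (w k)\<close> into each function.\<close>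

lemma bessel_weighted:
  fixes e :: "'i \<Rightarrow> 'k \<Rightarrow> real"
  assumes "finite I" "\<And>k. k \<in> K \<Longrightarrow> 0 \<le> w k"
    and "\<And>i j. i \<in> I \<Longrightarrow> j \<in> I \<Longrightarrow> (\<Sum>k\<in>K. w k * (e i k * e j k)) = of_bool (i = j)"
  shows "(\<Sum>i\<in>I. (\<Sum>k\<in>K. w k * (e i k * h k))\<^sup>2) \<le> (\<Sum>k\<in>K. w k * (h k)\<^sup>2)"
proof -
  have *: "ip K (\<lambda>k. sqrt (w k) * f k) (\<lambda>k. sqrt (w k) * g k) = (\<Sum>k\<in>K. w k * (f k * g k))" for f g
  proof -
    have "sqrt (w k) * f k * (sqrt (w k) * g k) = (sqrt (w k) * sqrt (w k)) * (f k * g k)" for k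
      by (simp add: algebra_simps)
    then show ?thesis unfolding ip_def using assms(2) by (intro sum.cong) auto
  qed
  show ?thesis
    using bessel[OF assms(1), of K "\<lambda>i k. sqrt (w k) * e i k" "\<lambda>k. sqrt (w k) * h k"] assms(3)
    by (simp add: * power2_eq_square)
qed

text \<open>On average over \<open>T\<close>, the squared distance of \<open>f T\<close> from a \<open>k\<close>-dimensional subspace is
  \<open>card X - k\<close>; choosing the \<open>T s\<close> greedily and orthonormalising gives a triangular system.\<close>
lemma greedy_triangular_system:
  fixes f :: "'o \<Rightarrow> 'x \<Rightarrow> real" and w :: "'o \<Rightarrow> real"
  assumes "finite \<Omega>" "finite X" and w0: "\<And>T. T \<in> \<Omega> \<Longrightarrow> 0 \<le> w T" and w1: "sum w \<Omega> = 1"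
    and orth: "\<And>a b. a \<in> X \<Longrightarrow> b \<in> X \<Longrightarrow> (\<Sum>T\<in>\<Omega>. w T * (f T a * f T b)) = of_bool (a = b)"
    and "k \<le> card X"
  shows "\<exists>(T :: nat \<Rightarrow> 'o) (q :: nat \<Rightarrow> 'x \<Rightarrow> real).
    (\<forall>s<k. T s \<in> \<Omega>) \<and> (\<forall>s<k. \<forall>t<k. ip X (q s) (q t) = of_bool (s = t)) \<and>
    (\<forall>s<k. \<forall>t<s. ip X (q s) (f (T t)) = 0) \<and>
    (\<forall>s<k. sqrt (real (card X - s)) \<le> ip X (q s) (f (T s))) \<and>
    (\<forall>t<k. \<forall>g. (\<forall>s<k. ip X g (q s) = 0) \<longrightarrow> ip X g (f (T t)) = 0)"
  using assms(6)
proof (induction k)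
  case 0
  show ?case by simp
next
  case (Suc k)
  then obtain T q where IH: "(\<forall>s<k. T s \<in> \<Omega>) \<and> (\<forall>s<k. \<forall>t<k. ip X (q s) (q t) = of_bool (s = t)) \<and>
    (\<forall>s<k. \<forall>t<s. ip X (q s) (f (T t)) = 0) \<and>
    (\<forall>s<k. sqrt (real (card X - s)) \<le> ip X (q s) (f (T s))) \<and>
    (\<forall>t<k. \<forall>g. (\<forall>s<k. ip X g (q s) = 0) \<longrightarrow> ip X g (f (T t)) = 0)"
    using Suc_leD by blast
  have T: "\<And>s. s < k \<Longrightarrow> T s \<in> \<Omega>"
    and q: "\<And>s t. s < k \<Longrightarrow> t < k \<Longrightarrow> ip X (q s) (q t) = of_bool (s = t)"
    and tri: "\<And>s t. s < k \<Longrightarrow> t < s \<Longrightarrow> ip X (q s) (f (T t)) = 0"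
    and diag: "\<And>s. s < k \<Longrightarrow> sqrt (real (card X - s)) \<le> ip X (q s) (f (T s))"
    and span: "\<And>t g. t < k \<Longrightarrow> (\<And>s. s < k \<Longrightarrow> ip X g (q s) = 0) \<Longrightarrow> ip X g (f (T t)) = 0"
    using IH by blast+
  define r where "r S = (\<lambda>a. f S a - lincomb q {..<k} (\<lambda>s. ip X (q s) (f S)) a)" for S
  have rr: "ip X (r S) (r S) = ip X (f S) (f S) - (\<Sum>s<k. (ip X (q s) (f S))\<^sup>2)" for S
    unfolding r_def using q by (intro ip_residual_orthonormal(1)) auto
  have rq: "ip X (r S) (q s) = 0" if "s < k" for S s
    unfolding r_def using q that by (intro ip_residual_orthonormal(2)) auto
  have avg1: "(\<Sum>S\<in>\<Omega>. w S * ip X (f S) (f S)) = real (card X)"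
  proof -
    have "(\<Sum>S\<in>\<Omega>. w S * ip X (f S) (f S)) = (\<Sum>a\<in>X. \<Sum>S\<in>\<Omega>. w S * (f S a * f S a))"
      unfolding ip_def sum_distrib_left by (rule sum.swap)
    then show ?thesis using orth by simp
  qed
  \<comment> \<open>By orthonormality of the coordinate functions, the vectors \<open>f S\<close>
    are isotropic on average.\<close>
  have avg2: "(\<Sum>S\<in>\<Omega>. w S * (ip X g (f S))\<^sup>2) = ip X g g" for g
  proof -
    have "(\<Sum>S\<in>\<Omega>. w S * (ip X g (f S))\<^sup>2) = (\<Sum>S\<in>\<Omega>. \<Sum>a\<in>X. \<Sum>b\<in>X. g a * g b * (w S * (f S a * f S b)))"
      unfolding ip_def power2_eq_square sum_product sum_distrib_left
      by (intro sum.cong) (auto simp: algebra_simps sum_distrib_left)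
    also have "\<dots> = (\<Sum>a\<in>X. \<Sum>b\<in>X. \<Sum>S\<in>\<Omega>. g a * g b * (w S * (f S a * f S b)))"
      by (subst sum.swap) (intro sum.cong refl sum.swap)
    also have "\<dots> = (\<Sum>a\<in>X. \<Sum>b\<in>X. if a = b then g a * g b else 0)"
      unfolding sum_distrib_left[symmetric] using orth by (intro sum.cong) auto
    also have "\<dots> = ip X g g" unfolding ip_def using assms(2) by (intro sum.cong) auto
    finally show ?thesis .
  qed
  define c where "c = real (card X) - real k"
  have avg: "(\<Sum>S\<in>\<Omega>. w S * ip X (r S) (r S)) = c"
  proof -
    have "(\<Sum>S\<in>\<Omega>. w S * ip X (r S) (r S))
        = real (card X) - (\<Sum>S\<in>\<Omega>. \<Sum>s<k. w S * (ip X (q s) (f S))\<^sup>2)"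
      unfolding rr avg1[symmetric] by (simp add: algebra_simps sum_subtractf sum_distrib_left)
    also have "(\<Sum>S\<in>\<Omega>. \<Sum>s<k. w S * (ip X (q s) (f S))\<^sup>2) = (\<Sum>s<k. ip X (q s) (q s))"
      unfolding avg2[symmetric] by (rule sum.swap)
    also have "\<dots> = real k" using q by simp
    finally show ?thesis by (simp add: c_def)
  qed
  \<comment> \<open>The weights are nonnegative with sum 1, so some squared residual reaches the
    average \<open>c\<close>.\<close>
  have "\<exists>S\<in>\<Omega>. c \<le> ip X (r S) (r S)"
  proof (rule ccontr)
    assume "\<not> ?thesis"
    then have less: "ip X (r S) (r S) < c" if "S \<in> \<Omega>" for S using that by force
    have "(\<Sum>S\<in>\<Omega>. w S * (c - ip X (r S) (r S))) = 0"
      using avg w1 by (simp add: algebra_simps sum_subtractf sum_distrib_left[symmetric])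
    moreover have "0 \<le> w S * (c - ip X (r S) (r S))" if "S \<in> \<Omega>" for S
      using less[OF that] w0[OF that] by simp
    ultimately have "\<forall>S\<in>\<Omega>. w S * (c - ip X (r S) (r S)) = 0"
      using assms(1) by (subst (asm) sum_nonneg_eq_0_iff) auto
    then have "w S = 0" if "S \<in> \<Omega>" for S using less[OF that] that by fastforce
    then show False using w1 by simp
  qed
  then obtain S where S: "S \<in> \<Omega>" "c \<le> ip X (r S) (r S)" by blast
  define \<rho> where "\<rho> = sqrt (ip X (r S) (r S))"
  have "c > 0" using Suc.prems by (simp add: c_def)
  then have \<rho>: "\<rho> > 0" "\<rho> * \<rho> = ip X (r S) (r S)" using S by (auto simp: \<rho>_def)
  define p where "p = (\<lambda>a. 1 / \<rho> * r S a)"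
  have pl: "ip X p h = ip X (r S) h / \<rho>" for h
    unfolding p_def by (subst ip_scale_left) simp
  have pq: "ip X p (q s) = 0" if "s < k" for s using rq[OF that] by (simp add: pl)
  have qp: "ip X (q s) p = 0" if "s < k" for s
    using pq[OF that] by (simp only: ip_commute[of X "q s" p])
  have rf: "ip X (r S) (f S) = \<rho> * \<rho>"
  proof -
    have "ip X (r S) (r S) = ip X (r S) (f S) - (\<Sum>s<k. ip X (q s) (f S) * ip X (r S) (q s))"
      by (subst (2) r_def) (simp only: ip_diff_right ip_lincomb_right)
    then show ?thesis using rq \<rho>(2) by simp
  qed
  have pp: "ip X p p = 1"
    unfolding pl ip_commute[of X "r S" p] \<rho>(2)[symmetric] using \<rho>(1) by simp
  have fS: "ip X g (f S) = \<rho> * ip X g p + (\<Sum>s<k. ip X (q s) (f S) * ip X g (q s))" for g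
  proof -
    have "ip X g (r S) = ip X g (f S) - (\<Sum>s<k. ip X (q s) (f S) * ip X g (q s))"
      unfolding r_def by (simp only: ip_diff_right ip_lincomb_right)
    moreover have "\<rho> * ip X g p = ip X g (r S)"
      using \<rho>(1) unfolding p_def ip_scale_right by simp
    ultimately show ?thesis by simp
  qed
  define T' where "T' = T(k := S)"
  define q' where "q' = q(k := p)"
  have "T' s \<in> \<Omega>" if "s < Suc k" for s using T S that by (auto simp: T'_def less_Suc_eq)
  moreover have "ip X (q' s) (q' t) = of_bool (s = t)" if "s < Suc k" "t < Suc k" for s t
    using q pq qp pp that by (auto simp: q'_def less_Suc_eq)
  moreover have "ip X (q' s) (f (T' t)) = 0" if "s < Suc k" "t < s" for s t
    using tri[of s t] span[of t p] pq that by (auto simp: q'_def T'_def less_Suc_eq)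
  moreover have "sqrt (real (card X - s)) \<le> ip X (q' s) (f (T' s))" if "s < Suc k" for s
  proof (cases "s = k")
    case True
    have "ip X p (f S) = \<rho>" unfolding pl rf using \<rho>(1) by simp
    moreover have "sqrt (real (card X - k)) \<le> \<rho>"
      unfolding \<rho>_def using S(2) Suc.prems by (simp add: c_def of_nat_diff)
    ultimately show ?thesis using True by (simp add: q'_def T'_def)
  next
    case False
    then show ?thesis using diag[of s] that by (simp add: q'_def T'_def)
  qed
  \<comment> \<open>Dual form of \<open>f (T' t)\<close> lying in the span of the
    \<open>q' s\<close>. In the induction this is what makes a new \<open>q\<close> orthogonal to
    all earlier \<open>f (T t)\<close>.\<close>
  moreover have "ip X g (f (T' t)) = 0" if "t < Suc k" and g: "\<And>s. s < Suc k \<Longrightarrow> ip X g (q' s) = 0" for t g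
  proof -
    have g1: "ip X g (q s) = 0" if "s < k" for s using g[of s] that by (simp add: q'_def)
    have "ip X g p = 0" using g[of k] by (simp add: q'_def)
    then have "ip X g (f S) = 0" using fS[of g] g1 by simp
    then show ?thesis using span[of t g] g1 that(1) by (auto simp: T'_def less_Suc_eq)
  qed
  ultimately show ?case by (intro exI[of _ T'] exI[of _ q']) blast
qed

text \<open>A counting argument. Each of the \<open>16 ^ k\<close> residue vectors modulo 16 has an
  integer representative whose set sums are at most \<open>16 * H\<close>. By \<open>dom\<close> its
  image is short, so its \<open>k\<close> triangular coordinates are small on average. All
  representatives together contribute at least \<open>16 ^ k * exp (- k)\<close> to an exponential
  sum that the diagonal bounds from above.\<close>

lemma hereditary_lower_bound:
  fixes f :: "'o \<Rightarrow> 'x \<Rightarrow> real" and T :: "nat \<Rightarrow> 'o" and F :: "'o set set"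
  assumes H: "H > 0" and k: "k > 0" and \<sigma>: "\<sigma> > 0" and \<rho>: "\<rho> > 0"
    and col: "\<And>J. J \<subseteq> T ` {..<k} \<Longrightarrow> \<exists>chi\<in>colourings J. \<forall>S\<in>F. real_of_int \<bar>\<Sum>v\<in>S \<inter> J. chi v\<bar> \<le> H"
    and q: "\<And>s t. s < k \<Longrightarrow> t < k \<Longrightarrow> ip X (q s) (q t) = of_bool (s = t)"
    and tri: "\<And>s t. s < k \<Longrightarrow> t < s \<Longrightarrow> ip X (q s) (f (T t)) = 0"
    and diag: "\<And>s. s < k \<Longrightarrow> \<rho> \<le> ip X (q s) (f (T s))"
    and dom: "\<And>y R. (\<And>S. S \<in> F \<Longrightarrow> \<bar>\<Sum>v\<in>S \<inter> T ` {..<k}. y v\<bar> \<le> R) \<Longrightarrow> 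
       (\<Sum>a\<in>X. (\<sigma> * (\<Sum>v\<in>T ` {..<k}. y v * f v a))\<^sup>2) \<le> R\<^sup>2"
  shows "\<sigma> * \<rho> * sqrt (real k) \<le> 10 * H"
proof -
  \<comment> \<open>\<open>q t\<close> annihilates \<open>f (T s)\<close> for \<open>s < t\<close>
    but not \<open>f (T t)\<close>.\<close>
  have neq: "T s \<noteq> T t" if "s < t" "t < k" for s t
    using tri[of t s] diag[of t] \<rho> that by auto
  have inj: "inj_on T {..<k}"
    by (rule linorder_inj_onI) (use neq in auto)
  define N where "N = (\<Pi>\<^sub>E s\<in>{..<k}. {0..<16 :: int})"
  define R where "R = 16 * H"
  have R: "R > 0" using H by (simp add: R_def)
  \<comment> \<open>Four rounding steps give multiples of 16 approximating \<open>n\<close> with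
    error \<open>15 * H\<close>; the difference \<open>y\<close> is indexed by \<open>s < k\<close>,
    whereas the sets consist of the points \<open>T s\<close>.\<close>
  have "\<exists>y :: nat \<Rightarrow> int. (\<forall>s<k. y s mod 16 = (- n s) mod 16) \<and> (\<forall>s\<ge>k. y s = 0) \<and>
     (\<forall>S\<in>F. real_of_int \<bar>\<Sum>v\<in>S \<inter> T ` {..<k}. y (the_inv_into {..<k} T v)\<bar> \<le> R)" for n :: "nat \<Rightarrow> int"
  proof -
    obtain x where x: "\<And>S. S \<in> F \<Longrightarrow> real_of_int \<bar>\<Sum>v\<in>S \<inter> T ` {..<k}. 2 ^ 4 * x v - n (the_inv_into {..<k} T v)\<bar> \<le> (2 ^ 4 - 1) * H"
      using hereditary_rounding[of "T ` {..<k}" F H 4 "\<lambda>v. n (the_inv_into {..<k} T v)"] col by auto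
    define y where "y s = (if s < k then 16 * x (T s) - n s else 0)" for s
    have "y s mod 16 = (- n s) mod 16" if "s < k" for s
    proof -
      have "y s = - n s + 16 * x (T s)" using that by (simp add: y_def)
      then show ?thesis by (simp only: mod_mult_self2)
    qed
    moreover have "real_of_int \<bar>\<Sum>v\<in>S \<inter> T ` {..<k}. y (the_inv_into {..<k} T v)\<bar> \<le> R" if "S \<in> F" for S
    proof -
      have "(\<Sum>v\<in>S \<inter> T ` {..<k}. y (the_inv_into {..<k} T v))
          = (\<Sum>v\<in>S \<inter> T ` {..<k}. 2 ^ 4 * x v - n (the_inv_into {..<k} T v))"
        by (intro sum.cong) (auto simp: y_def the_inv_into_f_f[OF inj])
      then show ?thesis using x[OF that] H by (simp add: R_def)
    qed
    ultimately show ?thesis by (intro exI[of _ y]) (auto simp: y_def)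
  qed
  then obtain Y :: "(nat \<Rightarrow> int) \<Rightarrow> nat \<Rightarrow> int" where Y: "\<And>n s. s < k \<Longrightarrow> Y n s mod 16 = (- n s) mod 16"
    "\<And>n s. k \<le> s \<Longrightarrow> Y n s = 0"
    "\<And>n S. S \<in> F \<Longrightarrow> real_of_int \<bar>\<Sum>v\<in>S \<inter> T ` {..<k}. Y n (the_inv_into {..<k} T v)\<bar> \<le> R"
    by metis
  have injY: "inj_on Y N"
  proof (rule inj_onI)
    fix n n' assume n: "n \<in> N" "n' \<in> N" "Y n = Y n'"
    have "n s = n' s" if "s < k" for s
    proof -
      have "(- n s) mod 16 = (- n' s) mod 16" using Y(1)[OF that] n(3) by metis
      then have "16 dvd (- n s) - (- n' s)" by (rule mod_eq_dvd_iff[THEN iffD1])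
      moreover have "0 \<le> n s" "n s < 16" "0 \<le> n' s" "n' s < 16" 
        using PiE_mem[OF n(1)[unfolded N_def], of s] PiE_mem[OF n(2)[unfolded N_def], of s] that by simp_all
      ultimately show ?thesis by presburger
    qed
    then show "n = n'" by (intro PiE_ext[OF n(1,2)[unfolded N_def]]) simp
  qed
  have finN: "finite N" unfolding N_def by (intro finite_PiE) auto
  have cardY: "card (Y ` N) = 16 ^ k"
    using card_image[OF injY] by (simp add: N_def card_PiE)
  \<comment> \<open>With this scale, an image of norm \<open>R\<close> has coordinates of mean
    square at most 1, so their absolute values sum to at most \<open>k\<close>.\<close>
  define \<kappa> where "\<kappa> = sqrt (real k) / R"
  have \<kappa>: "\<kappa> > 0" using k R by (simp add: \<kappa>_def)
  define h where "h s = \<kappa> * \<sigma> * ip X (q s) (f (T s))" for s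
  \<comment> \<open>Terms with \<open>t < s\<close> vanish by \<open>tri\<close>, so the shift of
    form \<open>s\<close> involves only later coordinates.\<close>
  define g where "g s y = \<kappa> * \<sigma> * (\<Sum>t\<in>{s<..<k}. real_of_int (y t) * ip X (q s) (f (T t)))" for s y
  define h0 where "h0 = \<kappa> * \<sigma> * \<rho>"
  have h0: "h0 > 0" using \<kappa> \<sigma> \<rho> by (simp add: h0_def)
  have small: "(\<Sum>s<k. \<bar>h s * real_of_int (y s) + g s y\<bar>) \<le> real k" if y: "y \<in> Y ` N" for y
  proof -
    obtain n where n: "y = Y n" using y by auto
    define B where "B = (\<lambda>a. \<Sum>t\<in>{..<k}. (\<sigma> * real_of_int (y t)) * f (T t) a)"
    have "ip X B B = (\<Sum>a\<in>X. (\<sigma> * (\<Sum>v\<in>T ` {..<k}. real_of_int (y (the_inv_into {..<k} T v)) * f v a))\<^sup>2)"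
    proof -
      have "B a = \<sigma> * (\<Sum>v\<in>T ` {..<k}. real_of_int (y (the_inv_into {..<k} T v)) * f v a)" for a
        unfolding B_def sum.reindex[OF inj] sum_distrib_left
        by (intro sum.cong) (auto simp: the_inv_into_f_f[OF inj])
      then show ?thesis by (simp add: ip_def power2_eq_square)
    qed
    also have "\<dots> \<le> R\<^sup>2" by (rule dom) (use Y(3)[of _ n] n in simp)
    finally have BB: "ip X B B \<le> R\<^sup>2" .
    have z: "h s * real_of_int (y s) + g s y = \<kappa> * ip X (q s) B" if s: "s < k" for s
    proof -
      have "ip X (q s) B = (\<Sum>t\<in>{..<k}. \<sigma> * real_of_int (y t) * ip X (q s) (f (T t)))"
        unfolding B_def by (rule ip_sum_right)
      also have "\<dots> = (\<Sum>t\<in>insert s {s<..<k}. \<sigma> * real_of_int (y t) * ip X (q s) (f (T t)))"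
        using s tri[OF s] by (intro sum.mono_neutral_right) auto
      also have "\<dots> = \<sigma> * real_of_int (y s) * ip X (q s) (f (T s))
          + (\<Sum>t\<in>{s<..<k}. \<sigma> * real_of_int (y t) * ip X (q s) (f (T t)))"
        by simp
      finally show ?thesis
        by (simp add: h_def g_def algebra_simps sum_distrib_left)
    qed
    have "(\<Sum>s<k. \<bar>h s * real_of_int (y s) + g s y\<bar>) = (\<Sum>s<k. \<bar>\<kappa> * ip X (q s) B\<bar>)"
      using z by (intro sum.cong) auto
    \<comment> \<open>Passing from absolute values to squares prepares for Bessel's
      inequality.\<close>
    also have "\<dots> \<le> (\<Sum>s<k. 1 / 2 + \<kappa>\<^sup>2 / 2 * (ip X (q s) B)\<^sup>2)"
    proof (rule sum_mono)
      fix s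
      have "0 \<le> (\<bar>\<kappa> * ip X (q s) B\<bar> - 1)\<^sup>2" by simp
      also have "\<dots> = \<kappa>\<^sup>2 * (ip X (q s) B)\<^sup>2 - 2 * \<bar>\<kappa> * ip X (q s) B\<bar> + 1"
        by (simp add: power2_diff power_mult_distrib)
      finally show "\<bar>\<kappa> * ip X (q s) B\<bar> \<le> 1 / 2 + \<kappa>\<^sup>2 / 2 * (ip X (q s) B)\<^sup>2" by simp
    qed
    also have "\<dots> = real k / 2 + \<kappa>\<^sup>2 / 2 * (\<Sum>s<k. (ip X (q s) B)\<^sup>2)"
      by (simp add: sum.distrib sum_distrib_left)
    also have "\<dots> \<le> real k / 2 + \<kappa>\<^sup>2 / 2 * R\<^sup>2"
    proof -
      have "(\<Sum>s<k. (ip X (q s) B)\<^sup>2) \<le> ip X B B" using q by (intro bessel) auto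
      then show ?thesis using BB by (intro add_left_mono mult_left_mono) auto
    qed
    also have "\<dots> = real k" using R by (simp add: \<kappa>_def power_divide)
    finally show ?thesis .
  qed
  have "16 ^ k * exp (- real k) = (\<Sum>y\<in>Y ` N. exp (- real k))" by (simp add: cardY)
  also have "\<dots> \<le> (\<Sum>y\<in>Y ` N. exp (- (\<Sum>s<k. \<bar>h s * real_of_int (y s) + g s y\<bar>)))"
    using small by (intro sum_mono) auto
  also have "\<dots> \<le> (2 + 2 / h0) ^ k"
  proof (rule triangular_exp_sum_le)
    show "finite (Y ` N)" using finN by simp
    show "h0 \<le> h s" if "s < k" for s
      using diag[OF that] \<kappa> \<sigma> by (simp add: h_def h0_def)
    show "y = y'" if "y \<in> Y ` N" "y' \<in> Y ` N" "\<And>t. t < k \<Longrightarrow> y t = y' t" for y y'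
    proof
      fix t show "y t = y' t" using that Y(2)[of t] by (cases "t < k") auto
    qed
    show "g s y = g s y'" if "\<And>t. s < t \<Longrightarrow> t < k \<Longrightarrow> y t = y' t" for s y y'
      using that by (auto simp: g_def intro!: sum.cong)
  qed (rule h0)
  also have "16 ^ k * exp (- real k) = (16 / exp 1) ^ k"
    using exp_of_nat_mult[of k "1 :: real"] by (simp add: power_divide exp_minus divide_inverse power_inverse)
  \<comment> \<open>As \<open>exp 1\<close> is at most 3, this forces \<open>h0\<close> to be at
    most 3/5, so \<open>\<sigma> * \<rho> * sqrt (real k)\<close> is at most
    \<open>9.6 * H\<close>.\<close>
  finally have "16 / exp 1 \<le> 2 + 2 / h0"
    using k h0 by (subst (asm) power_mono_iff) auto
  moreover have "16 / 3 \<le> 16 / exp (1 :: real)" using exp_le by (intro divide_left_mono) auto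
  ultimately have "10 / 3 \<le> 2 / h0" by linarith
  then have "h0 \<le> 3 / 5" using h0 by (simp add: field_simps)
  then show ?thesis using R H by (simp add: h0_def \<kappa>_def R_def field_simps)
qed

section \<open>Anchored boxes: lower bound\<close>

text \<open>Singular value decomposition of the matrix with rows \<open>(1, 0)\<close> and \<open>(1, 1)\<close> as an operator from
  \<open>L\<^sup>2\<close> of the column weights \<open>(2/3, 1/3)\<close> to \<open>L\<^sup>2\<close> of the row weights \<open>(1/3, 2/3)\<close>. These weights
  maximise the sum of the singular values, which becomes \<open>2 / sqrt 3\<close>.\<close>
definition row_wt :: "bool \<Rightarrow> real" where
  "row_wt s = (if s then 2 / 3 else 1 / 3)"

definition col_wt :: "bool \<Rightarrow> real" where
  "col_wt t = (if t then 1 / 3 else 2 / 3)"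

definition sing :: "bool \<Rightarrow> real" where
  "sing c = (if c then (sqrt 3 - 1) / 3 else (sqrt 3 + 1) / 3)"

text \<open>The normalisation giving the singular vectors norm 1 in the weighted spaces.\<close>

definition vec_scale :: real where
  "vec_scale = sqrt ((3 + sqrt 3) / 4)"

definition row_vec :: "bool \<Rightarrow> bool \<Rightarrow> real" where
  "row_vec c s = (if c then (if s then (sqrt 3 - 1) * vec_scale * (sqrt 2 / 2) else - (sqrt 2 * vec_scale))
     else if s then vec_scale else (sqrt 3 - 1) * vec_scale)"

definition col_vec :: "bool \<Rightarrow> bool \<Rightarrow> real" where
  "col_vec c t = (if c then (if t then sqrt 2 * vec_scale else - ((sqrt 3 - 1) * vec_scale * (sqrt 2 / 2)))
     else if t then (sqrt 3 - 1) * vec_scale else vec_scale)"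

lemma vec_scale_square: "vec_scale * vec_scale = (3 + sqrt 3) / 4"
  by (simp add: vec_scale_def)

lemma row_vec_orthonormal:
  "row_wt True * (row_vec c True * row_vec c' True) + row_wt False * (row_vec c False * row_vec c' False)
   = of_bool (c = c')"
proof -
  define a where "a = sqrt (3 :: real)"
  define b where "b = sqrt (2 :: real)"
  define v where "v = vec_scale"
  have a: "a * a = 3" and b: "b * b = 2" and v: "v * v = (3 + a) / 4"
    using vec_scale_square by (auto simp: a_def b_def v_def)
  have a': "a * (a * x) = 3 * x" and b': "b * (b * x) = 2 * x" and v': "v * (v * x) = (3 + a) / 4 * x" for x
    by (simp_all only: mult.assoc[symmetric] a b v)
  show ?thesis
    unfolding row_wt_def row_vec_def a_def[symmetric] b_def[symmetric] v_def[symmetric]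
    by (cases c; cases c')
      (simp_all add: algebra_simps add_divide_distrib diff_divide_distrib a b v a' b' v')
qed

text \<open>Columns mirror rows under negation of the argument, up to the sign of the
  vector.\<close>

lemma col_vec_orthonormal:
  "col_wt True * (col_vec c True * col_vec c' True) + col_wt False * (col_vec c False * col_vec c' False)
   = of_bool (c = c')"
proof -
  have "col_wt t = row_wt (\<not> t)" for t by (simp add: col_wt_def row_wt_def)
  moreover have "col_vec c t = (if c then -1 else 1) * row_vec c (\<not> t)" for c t
    by (simp add: col_vec_def row_vec_def)
  ultimately show ?thesis
    using row_vec_orthonormal[of c c'] by (cases c; cases c') (simp_all add: add.commute)
qed

text \<open>The weighted adjoint of the 2 by 2 matrix maps row singular vectors to multiples of
  column singular vectors: its row \<open>True\<close> is constantly 1, its row \<open>False\<close>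
  is \<open>of_bool (\<not> t)\<close>.\<close>

lemma row_vec_sing:
  "row_wt True * row_vec c True + row_wt False * (row_vec c False * of_bool (\<not> t)) = sing c * col_vec c t"
proof -
  define a where "a = sqrt (3 :: real)"
  define b where "b = sqrt (2 :: real)"
  define v where "v = vec_scale"
  have a: "a * a = 3" by (simp add: a_def)
  have a2: "a * (a * x) = 3 * x" for x by (simp only: mult.assoc[symmetric] a)
  show ?thesis
    unfolding row_wt_def row_vec_def col_vec_def sing_def
      a_def[symmetric] b_def[symmetric] v_def[symmetric]
    by (cases c; cases t) (simp_all add: algebra_simps add_divide_distrib diff_divide_distrib a a2)
qed

lemma sing_sum: "sing True + sing False = 2 / sqrt 3"
  by (simp add: sing_def field_simps)

lemma sing_pos: "sing c > 0"
proof -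
  have "1 < sqrt (3 :: real)" by simp
  then have "0 < sqrt 3 - (1 :: real)" "0 < sqrt 3 + (1 :: real)" by linarith+
  then show ?thesis by (simp add: sing_def)
qed

section \<open>Singular functions of the incidence matrix of points and anchored boxes\<close>

lemma sum_cube_prod:
  fixes \<phi> :: "nat \<Rightarrow> bool \<Rightarrow> real"
  shows "(\<Sum>x\<in>cube d. \<Prod>i<d. \<phi> i (x i = 1)) = (\<Prod>i<d. \<phi> i True + \<phi> i False)"
proof -
  have "(\<Sum>x\<in>cube d. \<Prod>i<d. \<phi> i (x i = 1)) = (\<Sum>T\<in>Pow {..<d}. \<Prod>i<d. \<phi> i (vertex d T i = 1))"
    unfolding cube_eq by (subst sum.reindex[OF inj_on_vertex]) simp
  also have "\<dots> = (\<Sum>T\<in>Pow {..<d}. \<Prod>i<d. \<phi> i (i \<in> T))"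
    by (intro sum.cong prod.cong) (auto simp: vertex_def)
  finally show ?thesis by (simp add: sum_Pow_prod)
qed

lemma mem_vertex_Pow_iff:
  assumes "x \<in> cube d" "S \<subseteq> {..<d}"
  shows "x \<in> vertex d ` Pow S \<longleftrightarrow> (\<forall>i<d. x i = 1 \<longrightarrow> i \<in> S)"
proof -
  obtain T where T: "T \<subseteq> {..<d}" "x = vertex d T" using assms(1) by (auto simp: cube_eq)
  have "x \<in> vertex d ` Pow S \<longleftrightarrow> T \<in> Pow S"
    unfolding T(2) using T(1) assms(2) inj_on_vertex[of d] by (intro inj_on_image_mem_iff) auto
  also have "\<dots> \<longleftrightarrow> (\<forall>i<d. x i = 1 \<longrightarrow> i \<in> S)" using T by (auto simp: vertex_def)
  finally show ?thesis .
qed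

text \<open>\<open>X\<close> collects the coordinates in which the singular vector of index
  \<open>True\<close> is used.\<close>

definition row_fun :: "nat \<Rightarrow> nat set \<Rightarrow> nat set \<Rightarrow> real" where
  "row_fun d X S = (\<Prod>i<d. row_vec (i \<in> X) (i \<in> S))"

text \<open>The point comes first, so that \<open>col_fun d x\<close> is a vector indexed by
  \<open>X\<close>, the format of the greedy selection.\<close>

definition col_fun :: "nat \<Rightarrow> (nat \<Rightarrow> real) \<Rightarrow> nat set \<Rightarrow> real" where
  "col_fun d x X = (\<Prod>i<d. col_vec (i \<in> X) (x i = 1))"

definition row_weight :: "nat \<Rightarrow> nat set \<Rightarrow> real" where
  "row_weight d S = (\<Prod>i<d. row_wt (i \<in> S))"

definition col_weight :: "nat \<Rightarrow> (nat \<Rightarrow> real) \<Rightarrow> real" where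
  "col_weight d x = (\<Prod>i<d. col_wt (x i = 1))"

lemma row_weight_nonneg: "0 \<le> row_weight d S"
  by (auto simp: row_weight_def row_wt_def intro!: prod_nonneg)

lemma col_weight_nonneg: "0 \<le> col_weight d x"
  by (auto simp: col_weight_def col_wt_def intro!: prod_nonneg)

lemma sum_row_weight: "(\<Sum>S\<in>Pow {..<d}. row_weight d S) = 1"
  unfolding row_weight_def using sum_Pow_prod[of "\<lambda>_. row_wt" d] by (simp add: row_wt_def)

lemma sum_col_weight: "(\<Sum>x\<in>cube d. col_weight d x) = 1"
  unfolding col_weight_def using sum_cube_prod[of "\<lambda>_. col_wt" d] by (simp add: col_wt_def)

lemma row_fun_orthonormal:
  assumes "X \<subseteq> {..<d}" "Y \<subseteq> {..<d}"
  shows "(\<Sum>S\<in>Pow {..<d}. row_weight d S * (row_fun d X S * row_fun d Y S)) = of_bool (X = Y)"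
proof -
  have "(\<Sum>S\<in>Pow {..<d}. row_weight d S * (row_fun d X S * row_fun d Y S)) = (\<Prod>i<d. of_bool ((i \<in> X) = (i \<in> Y)))"
    using sum_Pow_prod[of "\<lambda>i s. row_wt s * (row_vec (i \<in> X) s * row_vec (i \<in> Y) s)" d]
    by (simp only: row_vec_orthonormal row_weight_def row_fun_def prod.distrib)
  also have "\<dots> = of_bool (X = Y)" unfolding prod_of_bool using assms by (intro arg_cong[of _ _ of_bool]) auto
  finally show ?thesis .
qed

lemma col_fun_orthonormal:
  assumes "X \<subseteq> {..<d}" "Y \<subseteq> {..<d}"
  shows "(\<Sum>x\<in>cube d. col_weight d x * (col_fun d x X * col_fun d x Y)) = of_bool (X = Y)"
proof -
  have "(\<Sum>x\<in>cube d. col_weight d x * (col_fun d x X * col_fun d x Y)) = (\<Prod>i<d. of_bool ((i \<in> X) = (i \<in> Y)))"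
    using sum_cube_prod[of "\<lambda>i s. col_wt s * (col_vec (i \<in> X) s * col_vec (i \<in> Y) s)" d]
    by (simp only: col_vec_orthonormal col_weight_def col_fun_def prod.distrib)
  also have "\<dots> = of_bool (X = Y)" unfolding prod_of_bool using assms by (intro arg_cong[of _ _ of_bool]) auto
  finally show ?thesis .
qed

text \<open>Membership in an anchored box is a product over the coordinates, so the one-coordinate
  relations multiply.\<close>

lemma row_fun_sing:
  assumes "x \<in> cube d"
  shows "(\<Sum>S\<in>Pow {..<d}. row_weight d S * (row_fun d X S * of_bool (x \<in> vertex d ` Pow S)))
    = (\<Prod>i<d. sing (i \<in> X)) * col_fun d x X"
proof -
  have "(\<Sum>S\<in>Pow {..<d}. row_weight d S * (row_fun d X S * of_bool (x \<in> vertex d ` Pow S)))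
      = (\<Sum>S\<in>Pow {..<d}. \<Prod>i<d. row_wt (i \<in> S) * (row_vec (i \<in> X) (i \<in> S) * of_bool (x i = 1 \<longrightarrow> i \<in> S)))"
    unfolding prod.distrib prod_of_bool row_weight_def row_fun_def
    using mem_vertex_Pow_iff[OF assms] by (intro sum.cong) auto
  also have "\<dots> = (\<Prod>i<d. row_wt True * (row_vec (i \<in> X) True * of_bool (x i = 1 \<longrightarrow> True))
      + row_wt False * (row_vec (i \<in> X) False * of_bool (x i = 1 \<longrightarrow> False)))"
    by (rule sum_Pow_prod)
  also have "\<dots> = (\<Prod>i<d. sing (i \<in> X) * col_vec (i \<in> X) (x i = 1))"
    by (simp add: row_vec_sing[symmetric])
  finally show ?thesis by (simp add: prod.distrib col_fun_def)
qed

lemma prod_sing: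
  assumes "X \<subseteq> {..<d}"
  shows "(\<Prod>i<d. sing (i \<in> X)) = sing True ^ card X * sing False ^ (d - card X)"
proof -
  have "(\<Prod>i<d. sing (i \<in> X)) = (\<Prod>i\<in>{..<d} - X. sing (i \<in> X)) * (\<Prod>i\<in>X. sing (i \<in> X))"
    using assms by (intro prod.subset_diff) auto
  also have "\<dots> = sing False ^ card ({..<d} - X) * sing True ^ card X" by simp
  also have "card ({..<d} - X) = d - card X" using assms by (subst card_Diff_subset) (auto intro: finite_subset)
  finally show ?thesis by simp
qed

text \<open>The function \<open>h\<close> of signed sums over boxes is bounded by \<open>R\<close>,
  hence also in mean square. Its coefficient at \<open>row_fun d X\<close> is the singular value
  times the combination of \<open>col_fun\<close> values, and Bessel's inequality is applied to the
  sets \<open>X\<close> of size \<open>m\<close>, which share one singular value.\<close>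

lemma anchored_boxes_dominate:
  assumes J: "J \<subseteq> cube d"
    and R: "\<And>S. S \<in> anchored_boxes d \<Longrightarrow> \<bar>\<Sum>v\<in>S \<inter> J. y v\<bar> \<le> R"
  shows "(\<Sum>X\<in>{X. X \<subseteq> {..<d} \<and> card X = m}.
    (sing True ^ m * sing False ^ (d - m) * (\<Sum>v\<in>J. y v * col_fun d v X))\<^sup>2) \<le> R\<^sup>2"
proof -
  have finJ: "finite J" using J finite_cube finite_subset by blast
  define h where "h S = (\<Sum>v\<in>J. y v * of_bool (v \<in> vertex d ` Pow S))" for S
  have h: "(h S)\<^sup>2 \<le> R\<^sup>2" if "S \<in> Pow {..<d}" for S
  proof -
    have "(\<Sum>v\<in>vertex d ` Pow S \<inter> J. y v) = h S"
      unfolding h_def using finJ by (intro sum.mono_neutral_cong_left) auto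
    then have "\<bar>h S\<bar> \<le> R" using R[OF anchored_boxI, of S] that by simp
    then show ?thesis using power_mono[of "\<bar>h S\<bar>" R 2] by simp
  qed
  have "sing True ^ m * sing False ^ (d - m) * (\<Sum>v\<in>J. y v * col_fun d v X)
      = (\<Sum>S\<in>Pow {..<d}. row_weight d S * (row_fun d X S * h S))"
    if X: "X \<subseteq> {..<d}" "card X = m" for X
  proof -
    have "sing True ^ m * sing False ^ (d - m) * (\<Sum>v\<in>J. y v * col_fun d v X)
        = (\<Sum>v\<in>J. y v * ((\<Prod>i<d. sing (i \<in> X)) * col_fun d v X))"
      unfolding prod_sing[OF X(1)] X(2) sum_distrib_left by (simp only: ac_simps)
    also have "\<dots> = (\<Sum>v\<in>J. y v * (\<Sum>S\<in>Pow {..<d}. row_weight d S * (row_fun d X S * of_bool (v \<in> vertex d ` Pow S))))"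
      using J by (intro sum.cong refl) (auto simp: row_fun_sing simp del: Pow_iff)
    also have "\<dots> = (\<Sum>S\<in>Pow {..<d}. \<Sum>v\<in>J. y v * (row_weight d S * (row_fun d X S * of_bool (v \<in> vertex d ` Pow S))))"
      unfolding sum_distrib_left by (rule sum.swap)
    also have "\<dots> = (\<Sum>S\<in>Pow {..<d}. row_weight d S * (row_fun d X S * h S))"
      unfolding h_def sum_distrib_left by (simp only: ac_simps)
    finally show ?thesis .
  qed
  then have "(\<Sum>X\<in>{X. X \<subseteq> {..<d} \<and> card X = m}.
      (sing True ^ m * sing False ^ (d - m) * (\<Sum>v\<in>J. y v * col_fun d v X))\<^sup>2)
      = (\<Sum>X\<in>{X. X \<subseteq> {..<d} \<and> card X = m}. (\<Sum>S\<in>Pow {..<d}. row_weight d S * (row_fun d X S * h S))\<^sup>2)"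
    by (intro sum.cong) auto
  also have "\<dots> \<le> (\<Sum>S\<in>Pow {..<d}. row_weight d S * (h S)\<^sup>2)"
    by (rule bessel_weighted) (auto simp: row_weight_nonneg row_fun_orthonormal simp del: Pow_iff)
  also have "\<dots> \<le> (\<Sum>S\<in>Pow {..<d}. row_weight d S * R\<^sup>2)"
    using h row_weight_nonneg by (intro sum_mono mult_left_mono) auto
  also have "\<dots> = R\<^sup>2" by (simp only: sum_row_weight sum_distrib_right[symmetric] mult_1_left)
  finally show ?thesis .
qed

text \<open>The largest of the \<open>d + 1\<close> terms of the binomial expansion is at least
  their average.\<close>

lemma large_binomial_term:
  fixes a b :: real
  shows "\<exists>m\<le>d. (a + b) ^ d \<le> real (d + 1) * (real (d choose m) * (a ^ m * b ^ (d - m)))"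
proof (rule ccontr)
  assume "\<not> ?thesis"
  then have "real (d + 1) * (real (d choose m) * (a ^ m * b ^ (d - m))) < (a + b) ^ d" if "m \<le> d" for m
    using that by force
  then have "(\<Sum>m\<le>d. real (d + 1) * (real (d choose m) * (a ^ m * b ^ (d - m)))) < (\<Sum>m\<le>d. (a + b) ^ d)"
    by (intro sum_strict_mono) auto
  then show False
    unfolding sum_distrib_left[symmetric] binomial_ring by (simp add: mult.assoc)
qed

text \<open>The largest binomial term picks a singular value \<open>s m\<close> whose multiplicity
  \<open>n\<close> satisfies \<open>(2 / sqrt 3) ^ d \<le> (d + 1) * n * s m\<close>; selecting half
  as many points yields a discrepancy of at least \<open>s m * n / 20\<close>.\<close>

theorem herdisc_anchored_boxes_ge:
  assumes "anchored_boxes d \<subseteq> F" "finite F"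
  shows "(2 / sqrt 3) ^ d \<le> 20 * (real d + 1) * real_of_int (herdisc (cube d) F)"
proof -
  define s where "s m = sing True ^ m * sing False ^ (d - m)" for m
  obtain m where m: "m \<le> d" "(2 / sqrt 3) ^ d \<le> real (d + 1) * (real (d choose m) * s m)"
    using large_binomial_term[where d = d and a = "sing True" and b = "sing False"] by (auto simp: sing_sum s_def)
  define XX where "XX = {X. X \<subseteq> {..<d} \<and> card X = m}"
  have finX: "finite XX" unfolding XX_def by simp
  have cardX: "card XX = d choose m" unfolding XX_def using n_subsets[of "{..<d}" m] by simp
  define n where "n = card XX"
  have n: "n > 0" using m cardX by (simp add: n_def)
  \<comment> \<open>Half of \<open>n\<close>, rounded up: both \<open>k\<close> itself and
    \<open>n - s\<close> for every \<open>s < k\<close> are at least \<open>n / 2\<close>.\<close>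
  define k where "k = (n + 1) div 2"
  have k: "k > 0" "k \<le> n" "real n / 2 \<le> real k" "2 * k \<le> n + 1" using n by (auto simp: k_def)
  have orth: "(\<Sum>x\<in>cube d. col_weight d x * (col_fun d x a * col_fun d x b)) = of_bool (a = b)"
    if "a \<in> XX" "b \<in> XX" for a b
    using that by (intro col_fun_orthonormal) (auto simp: XX_def)
  obtain T q where Tq: "(\<forall>s<k. T s \<in> cube d) \<and> (\<forall>s<k. \<forall>t<k. ip XX (q s) (q t) = of_bool (s = t)) \<and>
    (\<forall>s<k. \<forall>t<s. ip XX (q s) (col_fun d (T t)) = 0) \<and>
    (\<forall>s<k. sqrt (real (card XX - s)) \<le> ip XX (q s) (col_fun d (T s))) \<and>
    (\<forall>t<k. \<forall>g. (\<forall>s<k. ip XX g (q s) = 0) \<longrightarrow> ip XX g (col_fun d (T t)) = 0)"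
    using greedy_triangular_system[OF finite_cube[of d] finX col_weight_nonneg sum_col_weight orth, of k] k(2)
    unfolding n_def by blast
  have T: "T ` {..<k} \<subseteq> cube d" using Tq by auto
  have s0: "s m > 0" using sing_pos by (simp add: s_def)
  have diag: "sqrt (real n / 2) \<le> ip XX (q s) (col_fun d (T s))" if "s < k" for s
  proof -
    have "real n / 2 \<le> real (n - s)" using that k by (simp add: of_nat_diff)
    then have "sqrt (real n / 2) \<le> sqrt (real (n - s))" by simp
    also have "\<dots> \<le> ip XX (q s) (col_fun d (T s))" using Tq that by (simp add: n_def)
    finally show ?thesis .
  qed
  define h where "h = herdisc (cube d) F"
  have "F \<noteq> {}" using assms(1) anchored_boxes_nonempty[of d] by blast
  then have h0: "0 \<le> h" unfolding h_def by (rule herdisc_nonneg[OF finite_cube assms(2)])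
  \<comment> \<open>The counting bound needs a positive \<open>H\<close>, while \<open>h\<close> is
    only known to be nonnegative; \<open>e\<close> then tends to 0.\<close>
  have "s m * (real n / 20) \<le> real_of_int h + e" if e: "e > 0" for e
  proof -
    have "s m * sqrt (real n / 2) * sqrt (real k) \<le> 10 * (real_of_int h + e)"
    proof (rule hereditary_lower_bound)
      show "0 < real_of_int h + e" using h0 e by simp
      show "\<exists>chi\<in>colourings J. \<forall>S\<in>F. real_of_int \<bar>\<Sum>v\<in>S \<inter> J. chi v\<bar> \<le> real_of_int h + e"
        if J: "J \<subseteq> T ` {..<k}" for J
      proof -
        have "J \<subseteq> cube d" using J T by (rule order_trans)
        from herdisc_attained[OF finite_cube assms(2) this]
        obtain chi where chi: "chi \<in> colourings J" "\<forall>S\<in>F. \<bar>\<Sum>v\<in>S \<inter> J. chi v\<bar> \<le> h"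
          unfolding h_def by blast
        have "real_of_int \<bar>\<Sum>v\<in>S \<inter> J. chi v\<bar> \<le> real_of_int h + e" if "S \<in> F" for S
          using bspec[OF chi(2) that] e by linarith
        then show ?thesis using chi(1) by blast
      qed
      show "(\<Sum>a\<in>XX. (s m * (\<Sum>v\<in>T ` {..<k}. y v * col_fun d v a))\<^sup>2) \<le> R\<^sup>2"
        if "\<And>S. S \<in> F \<Longrightarrow> \<bar>\<Sum>v\<in>S \<inter> T ` {..<k}. y v\<bar> \<le> R" for y R
        unfolding XX_def s_def by (rule anchored_boxes_dominate[OF T]) (use that assms(1) in auto)
    qed (use k(1) s0 n Tq diag in auto)
    moreover have "real n / 2 \<le> sqrt (real n / 2) * sqrt (real k)"
    proof -
      have "real n / 2 = sqrt (real n / 2) * sqrt (real n / 2)" by simp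
      also have "\<dots> \<le> sqrt (real n / 2) * sqrt (real k)" using k(3) by (intro mult_left_mono) auto
      finally show ?thesis .
    qed
    then have "s m * (real n / 2) \<le> s m * (sqrt (real n / 2) * sqrt (real k))"
      using s0 by (intro mult_left_mono) auto
    ultimately show ?thesis by (simp add: mult.assoc)
  qed
  then have "s m * (real n / 20) \<le> real_of_int h" by (rule field_le_epsilon)
  then have "real (d + 1) * (s m * (real n / 20)) \<le> real (d + 1) * real_of_int h"
    by (intro mult_left_mono) auto
  then show ?thesis using m(2) by (simp add: h_def n_def cardX algebra_simps)
qed

section \<open>Asymptotics of the exponent\<close>

lemma log_herdisc_asymp:
  assumes "\<And>d. (2 / sqrt 3) ^ d \<le> 20 * (real d + 1) * h d"
    and "\<And>d. h d \<le> 32 * (real d + 1) * (2 / sqrt 3) ^ d"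
  shows "(\<lambda>d. log 2 (h d) - log 2 (2 / sqrt 3) * real d) \<in> o(\<lambda>d. real d)"
proof -
  have le: "\<bar>log 2 (h d) - log 2 (2 / sqrt 3) * real d\<bar> \<le> log 2 (32 * (real d + 1))" for d
  proof -
    define p where "p = (2 / sqrt (3 :: real)) ^ d"
    have p: "p > 0" by (simp add: p_def)
    have lp: "log 2 p = log 2 (2 / sqrt 3) * real d" unfolding p_def by (subst log_nat_power) auto
    \<comment> \<open>The lower bound makes \<open>h d\<close> positive, so the logarithm rules
      apply.\<close>
    have "0 < 20 * (real d + 1) * h d" using assms(1)[of d] p unfolding p_def by linarith
    then have h: "h d > 0" by (simp add: zero_less_mult_iff)
    have "log 2 p \<le> log 2 (32 * (real d + 1) * h d)"
    proof (intro log_mono)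
      \<comment> \<open>The constant is raised to 32 so that both directions have the same error
        term.\<close>
      have "20 * ((real d + 1) * h d) \<le> 32 * ((real d + 1) * h d)" using h by (intro mult_right_mono) auto
      then show "p \<le> 32 * (real d + 1) * h d" using assms(1)[of d] unfolding p_def mult.assoc by linarith
    qed (use p in auto)
    also have "\<dots> = log 2 (32 * (real d + 1)) + log 2 (h d)" using h by (intro log_mult_pos) auto
    finally have 1: "log 2 p \<le> log 2 (32 * (real d + 1)) + log 2 (h d)" .
    have "log 2 (h d) \<le> log 2 (32 * (real d + 1) * p)"
      using assms(2)[of d] h by (intro log_mono) (auto simp: p_def)
    also have "\<dots> = log 2 (32 * (real d + 1)) + log 2 p" using p by (intro log_mult_pos) auto
    finally show ?thesis using 1 lp by linarith
  qed
  have "(\<lambda>d. log 2 (32 * (real d + 1))) \<in> o(\<lambda>d. real d)" by real_asymp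
  moreover have "(\<lambda>d. log 2 (h d) - log 2 (2 / sqrt 3) * real d) \<in> O(\<lambda>d. log 2 (32 * (real d + 1)))"
    using order_trans[OF le abs_ge_self] by (intro bigoI[where c = 1] always_eventually allI) auto
  ultimately show ?thesis by (rule landau_o.big_small_trans[rotated])
qed

theorem theorem6p1:
  shows "(\<lambda>d. log 2 (real_of_int (herdisc (cube d) (subcubes d))) - log 2 (2 / sqrt 3) * real d)
           \<in> o(\<lambda>d. real d)
       \<and> (\<lambda>d. log 2 (real_of_int (herdisc (cube d) (anchored_boxes d))) - log 2 (2 / sqrt 3) * real d)
           \<in> o(\<lambda>d. real d)"
  \<comment> \<open>Both systems contain the anchored boxes and consist of subcubes, so the same two
    bounds apply to each.\<close>
  by (intro conjI log_herdisc_asymp herdisc_anchored_boxes_ge herdisc_subcubes_le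
      anchored_subset_subcubes finite_subcubes finite_anchored_boxes order.refl)

end
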